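(* Let $G_0=SU(\infty,q)$, $q\leqq\infty$. The bounded symmetric domain $D_0=G_0(\mathcal F)$, $\mathcal F=(0,V_-,V)$, is realized as the bounded domain consisting of all finitary linear maps $Z:V_-\to V_+$ such that $I-Z^*Z$ is positive definite; here $(0,F^{(1)},V)\in D_0$ corresponds to the map $Z=Z_{F^{(1)}}$ given by $\pi_-(x)\mapsto\pi_+(x)$ for $x\in F^{(1)}$. In that realization the action of $G_0$ is $$\begin{pmatrix}A&B\\C&D\end{pmatrix}:Z\mapsto(AZ+B)(CZ+D)^{-1}.$$
   Context: $V$ is the complex vector space with countable basis $E=\{\dots,e_{-2},e_{-1};e_1,\dots,e_q\}$ if $q<\infty$, $E=\{\dots,e_{-2},e_{-1};e_1,e_2,\dots\}$ if $q=\infty$, with hermitian form $h(e_i,e_j)=\delta_{i,j}$ for $i<0$, $h(e_i,e_j)=-\delta_{i,j}$ for $i>0$. $V_+=\mathrm{Span}\{e_i\mid i<0\}$, $V_-=\mathrm{Span}\{e_i\mid i>0\}$, and $\pi_\pm:V\to V_\pm$ are the $h$-orthogonal projections. $G=SL(\infty;\mathbb C)$ is the group of linear transformations of $V$ of determinant $1$ fixing all but finitely many elements of $E$, and $G_0=SU(\infty,q)$ is the subgroup preserving $h$. Elements of $G_0$ are written in block form relative to $V=V_+\oplus V_-$. The complex flag (Grassmann) manifold is $\mathcal Z_{\mathcal F,E}=G(\mathcal F)$, and $$D_0=G_0(\mathcal F)=\{(0,F^{(1)},V)\in\mathcal Z_{\mathcal F,E}\mid F^{(1)}\text{ is a maximal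 }h\text{-negative definite subspace of }V\}.$$ A linear map $Z:V_-\to V_+$ is finitary if its matrix relative to $E$ has only finitely many nonzero entries; $Z^*$ is the conjugate transpose of that matrix. *)

theory Defs
  imports
    "HOL-Analysis.Analysis"
    "HOL-Library.Poly_Mapping"
    "HOL-Library.Extended_Nat"
begin

section \<open>The space \<open>Vsp\<close> and the hermitian form\<close>

text \<open>
  Vectors are finite complex combinations of basis vectors indexed by integers. The type carries
  all integer indices; \<open>Vsp q\<close> is the span of those that occur for the given \<open>q \<le> \<infinity>\<close>.
\<close>

type_synonym cvec = "int \<Rightarrow>\<^sub>0 complex"

definition cscale :: "complex \<Rightarrow> cvec \<Rightarrow> cvec" where
  "cscale c = Poly_Mapping.map ((*) c)"

lemma lookup_cscale [simp]: "Poly_Mapping.lookup (cscale c x) i = c * Poly_Mapping.lookup x i"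
  by (simp add: cscale_def Poly_Mapping.map.rep_eq when_def)

interpretation cvec: vector_space cscale
  by unfold_locales (auto intro!: poly_mapping_eqI simp: lookup_add algebra_simps)

definition bvec :: "int \<Rightarrow> cvec" where
  "bvec i = Poly_Mapping.single i 1"

definition neg_idx :: "int set" where
  "neg_idx = {i. i < 0}"

definition pos_idx :: "enat \<Rightarrow> int set" where
  "pos_idx q = {i. 0 < i \<and> enat (nat i) \<le> q}"

definition basis :: "enat \<Rightarrow> cvec set" where
  "basis q = bvec ` (neg_idx \<union> pos_idx q)"

definition Vsp :: "enat \<Rightarrow> cvec set" where
  "Vsp q = cvec.span (basis q)"

definition V_plus :: "cvec set" where
  "V_plus = cvec.span (bvec ` neg_idx)"

definition V_minus :: "enat \<Rightarrow> cvec set" where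
  "V_minus q = cvec.span (bvec ` pos_idx q)"

text \<open>Linear in the first argument, conjugate linear in the second.\<close>

definition herm :: "cvec \<Rightarrow> cvec \<Rightarrow> complex" where
  "herm x y = (\<Sum>i\<in>Poly_Mapping.keys x.
     (if i < 0 then 1 else - 1) * Poly_Mapping.lookup x i * cnj (Poly_Mapping.lookup y i))"

definition herm_proj :: "cvec set \<Rightarrow> cvec \<Rightarrow> cvec" where
  "herm_proj U x = (THE y. y \<in> U \<and> (\<forall>z\<in>U. herm (x - y) z = 0))"

abbreviation \<pi>_plus :: "cvec \<Rightarrow> cvec" where
  "\<pi>_plus \<equiv> herm_proj V_plus"

abbreviation \<pi>_minus :: "enat \<Rightarrow> cvec \<Rightarrow> cvec" where
  "\<pi>_minus q \<equiv> herm_proj (V_minus q)"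

section \<open>Linear maps between subspaces and the groups\<close>

text \<open>
  Maps with a proper domain are extensional (\<open>undefined\<close> outside the domain), so that
  equality of functions is equality of maps.
\<close>

definition lin_maps :: "cvec set \<Rightarrow> cvec set \<Rightarrow> (cvec \<Rightarrow> cvec) set" where
  "lin_maps S T = {f \<in> S \<rightarrow>\<^sub>E T.
     (\<forall>x\<in>S. \<forall>y\<in>S. f (x + y) = f x + f y) \<and> (\<forall>c. \<forall>x\<in>S. f (cscale c x) = cscale c (f x))}"

definition entry :: "(cvec \<Rightarrow> cvec) \<Rightarrow> int \<Rightarrow> int \<Rightarrow> complex" where
  "entry f i j = Poly_Mapping.lookup (f (bvec j)) i"

definition moved :: "enat \<Rightarrow> (cvec \<Rightarrow> cvec) \<Rightarrow> int set" where
  "moved q g = {i \<in> neg_idx \<union> pos_idx q. g (bvec i) \<noteq> bvec i}"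

text \<open>
  If \<open>g\<close> fixes all but finitely many basis vectors, its matrix is block triangular with respect to
  the moved and the fixed basis vectors, with identity block on the fixed ones. So its determinant is
  that of the finite block on \<open>moved q g\<close>, here given by the Leibniz formula.
\<close>

definition fin_det :: "enat \<Rightarrow> (cvec \<Rightarrow> cvec) \<Rightarrow> complex" where
  "fin_det q g = (\<Sum>p | p permutes moved q g. of_int (sign p) * (\<Prod>i\<in>moved q g. entry g i (p i)))"

definition SL :: "enat \<Rightarrow> (cvec \<Rightarrow> cvec) set" where
  "SL q = {g \<in> lin_maps (Vsp q) (Vsp q). finite (moved q g) \<and> fin_det q g = 1}"

definition SU :: "enat \<Rightarrow> (cvec \<Rightarrow> cvec) set" where
  "SU q = {g \<in> SL q. \<forall>x\<in>Vsp q. \<forall>y\<in>Vsp q. herm (g x) (g y) = herm x y}"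

section \<open>The flag manifold and the domain\<close>

type_synonym flag = "cvec set \<times> cvec set \<times> cvec set"

definition act :: "(cvec \<Rightarrow> cvec) \<Rightarrow> flag \<Rightarrow> flag" where
  "act g = (\<lambda>(F0, F1, F2). (g ` F0, g ` F1, g ` F2))"

definition base_flag :: "enat \<Rightarrow> flag" where
  "base_flag q = ({0}, V_minus q, Vsp q)"

definition flag_manifold :: "enat \<Rightarrow> flag set" where
  "flag_manifold q = (\<lambda>g. act g (base_flag q)) ` SL q"

definition neg_def_subspace :: "enat \<Rightarrow> cvec set \<Rightarrow> bool" where
  "neg_def_subspace q W \<longleftrightarrow>
     cvec.subspace W \<and> W \<subseteq> Vsp q \<and> (\<forall>x\<in>W. x \<noteq> 0 \<longrightarrow> Re (herm x x) < 0)"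

definition maximal_neg_def :: "enat \<Rightarrow> cvec set \<Rightarrow> bool" where
  "maximal_neg_def q W \<longleftrightarrow>
     neg_def_subspace q W \<and> (\<forall>W'. neg_def_subspace q W' \<and> W \<subseteq> W' \<longrightarrow> W' = W)"

definition D0 :: "enat \<Rightarrow> flag set" where
  "D0 q = {({0}, F, Vsp q) | F. ({0}, F, Vsp q) \<in> flag_manifold q \<and> maximal_neg_def q F}"

section \<open>The matrix domain\<close>

definition finitary_maps :: "enat \<Rightarrow> (cvec \<Rightarrow> cvec) set" where
  "finitary_maps q = {Z \<in> lin_maps (V_minus q) V_plus.
     finite {(i, j). i \<in> neg_idx \<and> j \<in> pos_idx q \<and> entry Z i j \<noteq> 0}}"

definition conj_transpose :: "enat \<Rightarrow> (cvec \<Rightarrow> cvec) \<Rightarrow> cvec \<Rightarrow> cvec" where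
  "conj_transpose q Z = (THE W. W \<in> lin_maps V_plus (V_minus q) \<and>
     (\<forall>i\<in>neg_idx. \<forall>j\<in>pos_idx q. entry W j i = cnj (entry Z i j)))"

definition ip :: "cvec \<Rightarrow> cvec \<Rightarrow> complex" where
  "ip x y = (\<Sum>i\<in>Poly_Mapping.keys x. Poly_Mapping.lookup x i * cnj (Poly_Mapping.lookup y i))"

definition positive_definite_on :: "cvec set \<Rightarrow> (cvec \<Rightarrow> cvec) \<Rightarrow> bool" where
  "positive_definite_on U M \<longleftrightarrow>
     (\<forall>x\<in>U. \<forall>y\<in>U. ip (M x) y = ip x (M y)) \<and> (\<forall>x\<in>U. x \<noteq> 0 \<longrightarrow> 0 < Re (ip (M x) x))"

definition matrix_domain :: "enat \<Rightarrow> (cvec \<Rightarrow> cvec) set" where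
  "matrix_domain q =
     {Z \<in> finitary_maps q. positive_definite_on (V_minus q) (\<lambda>v. v - conj_transpose q Z (Z v))}"

text \<open>
  The finitary maps are the union of the spaces of matrices supported in the block
  \<open>{-n..-1} \<times> {1..n}\<close>. Each of these has its usual topology (entrywise convergence),
  and the union has the direct limit topology.
\<close>

definition finitary_block :: "enat \<Rightarrow> nat \<Rightarrow> (cvec \<Rightarrow> cvec) set" where
  "finitary_block q n = {Z \<in> finitary_maps q.
     \<forall>i\<in>neg_idx. \<forall>j\<in>pos_idx q. entry Z i j \<noteq> 0 \<longrightarrow> - int n \<le> i \<and> j \<le> int n}"

definition block_topology :: "enat \<Rightarrow> nat \<Rightarrow> (cvec \<Rightarrow> cvec) topology" where
  "block_topology q n = pullback_topology (finitary_block q n) (\<lambda>Z (i, j). entry Z i j) euclidean"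

definition finitary_topology :: "enat \<Rightarrow> (cvec \<Rightarrow> cvec) topology" where
  "finitary_topology q = topology (\<lambda>U. U \<subseteq> finitary_maps q \<and>
     (\<forall>n. openin (block_topology q n) (U \<inter> finitary_block q n)))"

lemma openin_finitary_topology:
  "openin (finitary_topology q) U \<longleftrightarrow> U \<subseteq> finitary_maps q \<and>
     (\<forall>n. openin (block_topology q n) (U \<inter> finitary_block q n))"
proof -
  have "istopology (\<lambda>U. U \<subseteq> finitary_maps q \<and>
     (\<forall>n. openin (block_topology q n) (U \<inter> finitary_block q n)))"
    unfolding istopology_def
  proof (intro conjI allI impI)
    fix S T :: "(cvec \<Rightarrow> cvec) set" and n
    assume S: "S \<subseteq> finitary_maps q \<and> (\<forall>n. openin (block_topology q n) (S \<inter> finitary_block q n))"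
      and T: "T \<subseteq> finitary_maps q \<and> (\<forall>n. openin (block_topology q n) (T \<inter> finitary_block q n))"
    then show "S \<inter> T \<subseteq> finitary_maps q" by blast
    have "S \<inter> T \<inter> finitary_block q n = (S \<inter> finitary_block q n) \<inter> (T \<inter> finitary_block q n)"
      by blast
    with S T show "openin (block_topology q n) (S \<inter> T \<inter> finitary_block q n)"
      by (simp add: openin_Int)
  next
    fix K :: "(cvec \<Rightarrow> cvec) set set" and n
    assume K: "\<forall>S\<in>K. S \<subseteq> finitary_maps q \<and>
      (\<forall>n. openin (block_topology q n) (S \<inter> finitary_block q n))"
    then show "\<Union> K \<subseteq> finitary_maps q" by blast
    have "\<Union> K \<inter> finitary_block q n = (\<Union>S\<in>K. S \<inter> finitary_block q n)" by blast
    moreover have "openin (block_topology q n) (\<Union>S\<in>K. S \<inter> finitary_block q n)"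
      by (rule openin_Union) (use K in blast)
    ultimately show "openin (block_topology q n) (\<Union> K \<inter> finitary_block q n)"
      by simp
  qed
  then show ?thesis
    by (simp add: finitary_topology_def topology_inverse')
qed

definition operator_bounded :: "enat \<Rightarrow> (cvec \<Rightarrow> cvec) set \<Rightarrow> bool" where
  "operator_bounded q S \<longleftrightarrow> (\<exists>c. \<forall>Z\<in>S. \<forall>v\<in>V_minus q.
     sqrt (Re (ip (Z v) (Z v))) \<le> c * sqrt (Re (ip v v)))"

definition bounded_domain :: "enat \<Rightarrow> (cvec \<Rightarrow> cvec) set \<Rightarrow> bool" where
  "bounded_domain q S \<longleftrightarrow> S \<noteq> {} \<and> openin (finitary_topology q) S \<and>
     connectedin (finitary_topology q) S \<and> operator_bounded q S"

section \<open>The realization and the action\<close>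

definition graph_map_of :: "enat \<Rightarrow> flag \<Rightarrow> (cvec \<Rightarrow> cvec) \<Rightarrow> bool" where
  "graph_map_of q = (\<lambda>(F0, F1, F2) Z.
     Z \<in> lin_maps (V_minus q) V_plus \<and> (\<forall>x\<in>F1. Z (\<pi>_minus q x) = \<pi>_plus x))"

definition Z_of :: "enat \<Rightarrow> flag \<Rightarrow> cvec \<Rightarrow> cvec" where
  "Z_of q F = (THE Z. graph_map_of q F Z)"

definition block_A :: "(cvec \<Rightarrow> cvec) \<Rightarrow> cvec \<Rightarrow> cvec" where
  "block_A g = (\<lambda>x\<in>V_plus. \<pi>_plus (g x))"

definition block_B :: "enat \<Rightarrow> (cvec \<Rightarrow> cvec) \<Rightarrow> cvec \<Rightarrow> cvec" where
  "block_B q g = (\<lambda>x\<in>V_minus q. \<pi>_plus (g x))"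

definition block_C :: "enat \<Rightarrow> (cvec \<Rightarrow> cvec) \<Rightarrow> cvec \<Rightarrow> cvec" where
  "block_C q g = (\<lambda>x\<in>V_plus. \<pi>_minus q (g x))"

definition block_D :: "enat \<Rightarrow> (cvec \<Rightarrow> cvec) \<Rightarrow> cvec \<Rightarrow> cvec" where
  "block_D q g = (\<lambda>x\<in>V_minus q. \<pi>_minus q (g x))"

definition numer :: "enat \<Rightarrow> (cvec \<Rightarrow> cvec) \<Rightarrow> (cvec \<Rightarrow> cvec) \<Rightarrow> cvec \<Rightarrow> cvec" where
  "numer q g Z = (\<lambda>v\<in>V_minus q. block_A g (Z v) + block_B q g v)"

definition denom :: "enat \<Rightarrow> (cvec \<Rightarrow> cvec) \<Rightarrow> (cvec \<Rightarrow> cvec) \<Rightarrow> cvec \<Rightarrow> cvec" where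
  "denom q g Z = (\<lambda>v\<in>V_minus q. block_C q g (Z v) + block_D q g v)"

definition frac_lin :: "enat \<Rightarrow> (cvec \<Rightarrow> cvec) \<Rightarrow> (cvec \<Rightarrow> cvec) \<Rightarrow> cvec \<Rightarrow> cvec" where
  "frac_lin q g Z = (\<lambda>v\<in>V_minus q. numer q g Z (inv_into (V_minus q) (denom q g Z) v))"

end

theory Submission
  imports "Jordan_Normal_Form.Determinant" Defs
begin

text \<open>
  A negative definite subspace meets \<open>V_+\<close> only in \<open>0\<close>, so it is a graph over its projection to
  \<open>V_-\<close>. If it is maximal and differs from \<open>V_-\<close> in only finitely many directions, the
  projection is all of \<open>V_-\<close>, and the subspace is the graph of a finitary \<open>Z\<close>; negativity of \<open>h\<close> on
  the vectors \<open>v + Z v\<close> says \<open>|Z v| < |v|\<close>, which is positivity of \<open>I - Z\<^sup>*Z\<close>. Conversely, the graphs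
  of \<open>Z\<close> and of \<open>Z\<^sup>*\<close> are \<open>h\<close>-orthogonal, negative and positive definite; Gram-Schmidt inside a
  finite block gives an isometry carrying \<open>V_-\<close> to the graph of \<open>Z\<close>, whose determinant has
  modulus one. Applying \<open>g\<close> to \<open>v + Z v\<close> and projecting to \<open>V_+\<close> and \<open>V_-\<close> gives the
  fractional linear action. The domain is star-shaped about \<open>0\<close>, hence connected.
\<close>

text \<open>Finitariness replaces them. A group element moves finitely many basis vectors, and a
  finitary \<open>Z\<close> has finitely many nonzero columns, so projections, Gram-Schmidt and
  determinants take place in the span of a finite set of basis vectors, chosen large enough to be
  stable under the maps at hand. Membership in the flag manifold is what supplies such a set for a
  maximal subspace.

  The sign of \<open>h\<close> does the rest: a vector of a negative definite subspace on which
  \<open>h\<close> is nonnegative is \<open>0\<close>. This one remark gives injectivity of the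
  projection to \<open>V_-\<close>, maximality of graphs, and that an isometry taking
  \<open>V_-\<close> into a graph takes it onto the graph. Openness of the domain needs a
  contraction constant below \<open>1\<close> valid for all vectors at once; it is obtained from
  transitivity, since a group element has a finite operator bound.\<close>

abbreviation lk :: "cvec \<Rightarrow> int \<Rightarrow> complex" where
  "lk \<equiv> Poly_Mapping.lookup"

section \<open>Coordinates, linear extension and coordinate projections\<close>

definition supp :: "int set \<Rightarrow> cvec set" where
  "supp S = {x. Poly_Mapping.keys x \<subseteq> S}"

lemma supp_iff: "x \<in> supp S \<longleftrightarrow> (\<forall>i. i \<notin> S \<longrightarrow> lk x i = 0)"
  by (auto simp: supp_def in_keys_iff)

lemma supp_mono: "S \<subseteq> T \<Longrightarrow> x \<in> supp S \<Longrightarrow> x \<in> supp T"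
  by (auto simp: supp_def)

lemma keys_supp: "x \<in> supp (Poly_Mapping.keys x)"
  by (simp add: supp_def)

lemma lk_bvec: "lk (bvec i) j = (if i = j then 1 else 0)"
  by (simp add: bvec_def lookup_single when_def)

lemma bvec_supp [simp]: "bvec i \<in> supp S \<longleftrightarrow> i \<in> S"
  by (auto simp: supp_iff lk_bvec)

lemma lk_sum: "lk (sum f A) i = (\<Sum>a\<in>A. lk (f a) i)"
  by (induction A rule: infinite_finite_induct) (auto simp: lookup_add)

lemma lk_minus: "lk (x - y) i = lk x i - lk y i"
  by (simp add: lookup_minus)

lemma subspace_supp [simp]: "cvec.subspace (supp S)"
  by (auto simp: cvec.subspace_def supp_iff lookup_add)

lemma cvec_expand:
  assumes "finite A" "x \<in> supp A"
  shows "x = (\<Sum>i\<in>A. cscale (lk x i) (bvec i))"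
proof (rule poly_mapping_eqI)
  fix k
  show "lk x k = lk (\<Sum>i\<in>A. cscale (lk x i) (bvec i)) k"
    using assms by (auto simp: lk_sum lk_bvec supp_iff if_distrib cong: if_cong)
qed

lemma span_bvec: "cvec.span (bvec ` S) = supp S"
proof
  show "cvec.span (bvec ` S) \<subseteq> supp S"
    by (rule cvec.span_minimal) auto
  show "supp S \<subseteq> cvec.span (bvec ` S)"
  proof
    fix x assume "x \<in> supp S"
    then have "Poly_Mapping.keys x \<subseteq> S" by (simp add: supp_def)
    then have "(\<Sum>i\<in>Poly_Mapping.keys x. cscale (lk x i) (bvec i)) \<in> cvec.span (bvec ` S)"
      by (intro cvec.span_sum cvec.span_scale cvec.span_base) auto
    then show "x \<in> cvec.span (bvec ` S)"
      using cvec_expand[OF finite_keys keys_supp] by metis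
  qed
qed

abbreviation idx :: "enat \<Rightarrow> int set" where
  "idx q \<equiv> neg_idx \<union> pos_idx q"

lemma V_plus_eq: "V_plus = supp neg_idx"
  and V_minus_eq: "V_minus q = supp (pos_idx q)"
  and Vsp_eq: "Vsp q = supp (idx q)"
  by (simp_all add: V_plus_def V_minus_def Vsp_def basis_def span_bvec)

lemma neg_pos_disjoint: "neg_idx \<inter> pos_idx q = {}"
  by (auto simp: neg_idx_def pos_idx_def)

lemma neg_idx_iff [simp]: "i \<in> neg_idx \<longleftrightarrow> i < 0"
  by (simp add: neg_idx_def)

lemma pos_idx_pos: "i \<in> pos_idx q \<Longrightarrow> 0 < i"
  by (simp add: pos_idx_def)

lemma V_plus_Vsp: "x \<in> V_plus \<Longrightarrow> x \<in> Vsp q"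
  and V_minus_Vsp: "x \<in> V_minus q \<Longrightarrow> x \<in> Vsp q"
  by (auto simp: V_plus_eq V_minus_eq Vsp_eq intro: supp_mono[rotated])

lemma subspaces [simp]: "cvec.subspace V_plus" "cvec.subspace (V_minus q)" "cvec.subspace (Vsp q)"
  by (simp_all add: V_plus_eq V_minus_eq Vsp_eq)

text \<open>The linear extension of prescribed values on basis vectors, as a total function: its
  linearity then carries no domain conditions. \<open>ext_lin\<close> cuts it down to an element of
  \<open>lin_maps\<close>, where equality of functions is equality of maps.\<close>

definition lin :: "(int \<Rightarrow> cvec) \<Rightarrow> cvec \<Rightarrow> cvec" where
  "lin b x = (\<Sum>i\<in>Poly_Mapping.keys x. cscale (lk x i) (b i))"

lemma lin_sum:
  assumes "finite A" "x \<in> supp A"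
  shows "lin b x = (\<Sum>i\<in>A. cscale (lk x i) (b i))"
  unfolding lin_def
  by (rule sum.mono_neutral_left) (use assms in \<open>auto simp: supp_def in_keys_iff\<close>)

lemma lin_add: "lin b (x + y) = lin b x + lin b y"
proof -
  let ?A = "Poly_Mapping.keys x \<union> Poly_Mapping.keys y"
  have "x + y \<in> supp ?A" "x \<in> supp ?A" "y \<in> supp ?A"
    by (auto simp: supp_iff lookup_add in_keys_iff)
  then show ?thesis
    by (simp add: lin_sum[of ?A] lookup_add cvec.scale_left_distrib sum.distrib)
qed

lemma lin_scale: "lin b (cscale c x) = cscale c (lin b x)"
proof -
  have "cscale c x \<in> supp (Poly_Mapping.keys x)"
    by (auto simp: supp_iff in_keys_iff)
  then show ?thesis
    by (simp add: lin_sum[of "Poly_Mapping.keys x"] keys_supp cvec.scale_sum_right)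
qed

lemma lin_bvec [simp]: "lin b (bvec i) = b i"
  by (subst lin_sum[of "{i}"]) (auto simp: lk_bvec)

lemma lin_mem:
  assumes "cvec.subspace T" "\<And>i. i \<in> S \<Longrightarrow> b i \<in> T" "x \<in> supp S"
  shows "lin b x \<in> T"
  unfolding lin_def
  by (rule cvec.subspace_sum[OF assms(1)], rule cvec.subspace_scale[OF assms(1)])
    (use assms in \<open>auto simp: supp_def\<close>)

definition ext_lin :: "int set \<Rightarrow> (int \<Rightarrow> cvec) \<Rightarrow> cvec \<Rightarrow> cvec" where
  "ext_lin S b = restrict (lin b) (supp S)"

lemma ext_lin_lin_maps:
  assumes "cvec.subspace T" "\<And>i. i \<in> S \<Longrightarrow> b i \<in> T"
  shows "ext_lin S b \<in> lin_maps (supp S) T"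
  using assms lin_mem[OF assms]
  by (auto simp: ext_lin_def lin_maps_def lin_add lin_scale cvec.subspace_add cvec.subspace_scale)

lemma ext_lin_bvec: "i \<in> S \<Longrightarrow> ext_lin S b (bvec i) = b i"
  by (simp add: ext_lin_def)

lemma ext_lin_apply: "x \<in> supp S \<Longrightarrow> ext_lin S b x = lin b x"
  by (simp add: ext_lin_def)

lemma lin_maps_add: "f \<in> lin_maps S T \<Longrightarrow> x \<in> S \<Longrightarrow> y \<in> S \<Longrightarrow> f (x + y) = f x + f y"
  and lin_maps_scale: "f \<in> lin_maps S T \<Longrightarrow> x \<in> S \<Longrightarrow> f (cscale c x) = cscale c (f x)"
  and lin_maps_mem: "f \<in> lin_maps S T \<Longrightarrow> x \<in> S \<Longrightarrow> f x \<in> T"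
  and lin_maps_ext: "f \<in> lin_maps S T \<Longrightarrow> x \<notin> S \<Longrightarrow> f x = undefined"
  by (auto simp: lin_maps_def)

lemma lin_maps_zero: "f \<in> lin_maps S T \<Longrightarrow> cvec.subspace S \<Longrightarrow> f 0 = 0"
  using lin_maps_scale[of f S T 0 0] by (simp add: cvec.subspace_0)

lemma lin_maps_diff:
  assumes "f \<in> lin_maps S T" "cvec.subspace S" "x \<in> S" "y \<in> S"
  shows "f (x - y) = f x - f y"
proof -
  have "f ((x - y) + y) = f (x - y) + f y"
    by (rule lin_maps_add[OF assms(1)]) (use assms in \<open>auto simp: cvec.subspace_diff\<close>)
  then show ?thesis by (simp add: algebra_simps)
qed

lemma lin_maps_sum:
  assumes "f \<in> lin_maps S T" "cvec.subspace S" "\<And>a. a \<in> A \<Longrightarrow> g a \<in> S"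
  shows "f (sum g A) = (\<Sum>a\<in>A. f (g a))"
  using assms(3)
proof (induction A rule: infinite_finite_induct)
  case (insert a A)
  then show ?case
    using assms(1,2) by (simp add: lin_maps_add cvec.subspace_sum)
qed (auto simp: lin_maps_zero[OF assms(1,2)])

lemma lin_maps_eq_lin:
  assumes "f \<in> lin_maps (supp S) T" "x \<in> supp S"
  shows "f x = lin (\<lambda>i. f (bvec i)) x"
proof -
  have k: "Poly_Mapping.keys x \<subseteq> S" using assms by (simp add: supp_def)
  have "f x = f (\<Sum>i\<in>Poly_Mapping.keys x. cscale (lk x i) (bvec i))"
    using cvec_expand[OF finite_keys keys_supp] by metis
  also have "\<dots> = (\<Sum>i\<in>Poly_Mapping.keys x. f (cscale (lk x i) (bvec i)))"
    by (rule lin_maps_sum[OF assms(1)])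
      (use k in \<open>auto intro!: cvec.subspace_scale[OF subspace_supp]\<close>)
  also have "\<dots> = lin (\<lambda>i. f (bvec i)) x"
    unfolding lin_def
    by (rule sum.cong) (use k in \<open>auto intro!: lin_maps_scale[OF assms(1)]\<close>)
  finally show ?thesis .
qed

lemma lin_maps_eqI:
  assumes "f \<in> lin_maps (supp S) T" "g \<in> lin_maps (supp S) U"
    "\<And>i. i \<in> S \<Longrightarrow> f (bvec i) = g (bvec i)"
  shows "f = g"
proof
  fix x
  show "f x = g x"
  proof (cases "x \<in> supp S")
    case True
    then have "lin (\<lambda>i. f (bvec i)) x = lin (\<lambda>i. g (bvec i)) x"
      using assms(3) by (auto simp: lin_def supp_def intro!: sum.cong)
    then show ?thesis
      using lin_maps_eq_lin[OF assms(1) True] lin_maps_eq_lin[OF assms(2) True] by simp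
  next
    case False
    then show ?thesis using assms by (simp add: lin_maps_ext)
  qed
qed

lemma subspace_lin_maps_image:
  assumes "f \<in> lin_maps S T" "cvec.subspace S"
  shows "cvec.subspace (f ` S)"
  unfolding cvec.subspace_def
proof (intro conjI ballI allI)
  show "0 \<in> f ` S"
    using lin_maps_zero[OF assms] cvec.subspace_0[OF assms(2)] by force
next
  fix x y assume "x \<in> f ` S" "y \<in> f ` S"
  then obtain u v where "u \<in> S" "v \<in> S" "x = f u" "y = f v" by auto
  then have "x + y = f (u + v)" "u + v \<in> S"
    using lin_maps_add[OF assms(1)] cvec.subspace_add[OF assms(2)] by auto
  then show "x + y \<in> f ` S" by blast
next
  fix c x assume "x \<in> f ` S"
  then obtain u where "u \<in> S" "x = f u" by auto
  then have "cscale c x = f (cscale c u)" "cscale c u \<in> S"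
    using lin_maps_scale[OF assms(1)] cvec.subspace_scale[OF assms(2)] by auto
  then show "cscale c x \<in> f ` S" by blast
qed

text \<open>A concrete stand-in for the description \<open>herm_proj\<close>; see
  \<open>\<pi>_plus_eq\<close> and \<open>\<pi>_minus_eq\<close>.\<close>

definition restr :: "int set \<Rightarrow> cvec \<Rightarrow> cvec" where
  "restr S x = (\<Sum>i\<in>Poly_Mapping.keys x \<inter> S. cscale (lk x i) (bvec i))"

lemma lk_restr: "lk (restr S x) i = (if i \<in> S then lk x i else 0)"
  by (auto simp: restr_def lk_sum lk_bvec if_distrib in_keys_iff cong: if_cong)

lemma restr_supp: "restr S x \<in> supp S"
  by (simp add: supp_iff lk_restr)

lemma restr_add: "restr S (x + y) = restr S x + restr S y"
  and restr_scale: "restr S (cscale c x) = cscale c (restr S x)"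
  and restr_diff: "restr S (x - y) = restr S x - restr S y"
  by (auto intro!: poly_mapping_eqI simp: lk_restr lookup_add lk_minus)

lemma restr_id: "x \<in> supp S \<Longrightarrow> restr S x = x"
  by (auto intro!: poly_mapping_eqI simp: lk_restr supp_iff)

lemma restr_0: "x \<in> supp S \<Longrightarrow> S \<inter> T = {} \<Longrightarrow> restr T x = 0"
  by (intro poly_mapping_eqI) (auto simp: lk_restr supp_iff)

lemma Vsp_decomp: "x \<in> Vsp q \<Longrightarrow> x = restr (pos_idx q) x + restr neg_idx x"
  using neg_pos_disjoint[of q]
  by (intro poly_mapping_eqI) (auto simp: lookup_add lk_restr Vsp_eq supp_iff)

section \<open>Hermitian forms on the finitely supported vectors\<close>

text \<open>Three forms are instances: \<open>ip\<close>, \<open>herm\<close> and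
  \<open>- herm\<close>. The last one lets Gram-Schmidt run on negative definite subspaces.
  Definiteness is therefore no axiom here and is assumed only on the span at hand.\<close>

locale hermitian_form =
  fixes H :: "cvec \<Rightarrow> cvec \<Rightarrow> complex"
  assumes add_left: "H (x + y) z = H x z + H y z"
    and scale_left: "H (cscale c x) z = c * H x z"
    and cnj_commute: "cnj (H x y) = H y x"
begin

lemma add_right: "H z (x + y) = H z x + H z y"
  by (metis add_left cnj_commute complex_cnj_add)

lemma scale_right: "H z (cscale c x) = cnj c * H z x"
  by (metis scale_left cnj_commute complex_cnj_mult)

lemma zero_left [simp]: "H 0 z = 0"
  using scale_left[of 0 0 z] by simp

lemma zero_right [simp]: "H z 0 = 0"
  using scale_right[of z 0 0] by simp

lemma diff_left: "H (x - y) z = H x z - H y z"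
  using add_left[of "x - y" y z] by simp

lemma diff_right: "H z (x - y) = H z x - H z y"
  using add_right[of z "x - y" y] by simp

lemma sum_left: "H (sum f A) z = (\<Sum>a\<in>A. H (f a) z)"
  by (induction A rule: infinite_finite_induct) (auto simp: add_left)

lemma sum_right: "H z (sum f A) = (\<Sum>a\<in>A. H z (f a))"
  by (induction A rule: infinite_finite_induct) (auto simp: add_right)

lemma self_real: "H x x = of_real (Re (H x x))"
  using cnj_commute[of x x] by (simp add: complex_eq_iff)

lemma orthogonal_span:
  assumes "x \<in> cvec.span B" "\<And>b. b \<in> B \<Longrightarrow> H u b = 0"
  shows "H u x = 0"
  using assms(1)
  by (induction rule: cvec.span_induct_alt) (auto simp: add_right scale_right assms(2))

text \<open>The span is built up one vector at a time. It is enough that the form has no isotropic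
  vector in the span; \<open>B\<close> may be dependent, since a \<open>b\<close> already in the
  span of the others gives \<open>w = 0\<close> and adds nothing.\<close>

lemma projection_exists:
  assumes "finite B" "\<And>y. y \<in> cvec.span B \<Longrightarrow> y \<noteq> 0 \<Longrightarrow> H y y \<noteq> 0"
  shows "\<exists>p\<in>cvec.span B. \<forall>b\<in>cvec.span B. H (u - p) b = 0"
  using assms
proof (induction B arbitrary: u rule: finite_induct)
  case empty
  then show ?case by simp
next
  case (insert b B)
  have IH: "\<exists>p\<in>cvec.span B. \<forall>b\<in>cvec.span B. H (u - p) b = 0" for u
    by (rule insert.IH, rule insert.prems) (use cvec.span_mono[of B "insert b B"] in auto)
  obtain p where p: "p \<in> cvec.span B" "\<forall>b\<in>cvec.span B. H (u - p) b = 0" using IH by blast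
  obtain r where r: "r \<in> cvec.span B" "\<forall>c\<in>cvec.span B. H (b - r) c = 0" using IH by blast
  have mono: "x \<in> cvec.span B \<Longrightarrow> x \<in> cvec.span (insert b B)" for x
    using cvec.span_mono[of B "insert b B"] by auto
  define w where "w = b - r"
  have w: "w \<in> cvec.span (insert b B)"
    unfolding w_def by (intro cvec.span_diff mono r(1) cvec.span_base) simp
  \<comment> \<open>\<open>w\<close> is the part of \<open>b\<close> orthogonal to
    \<open>cvec.span B\<close>, so adding the component of \<open>u - p\<close> along
    \<open>w\<close> keeps the orthogonality to \<open>cvec.span B\<close>.\<close>
  define s where "s = p + cscale (H (u - p) w / H w w) w"
  have sB: "s \<in> cvec.span (insert b B)"
    unfolding s_def by (intro cvec.span_add mono p(1) cvec.span_scale w)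
  have H_B: "H (u - s) c = 0" if "c \<in> cvec.span B" for c
    using that p r by (simp add: s_def w_def add_left diff_left scale_left algebra_simps)
  have H_w: "H (u - s) w = 0"
  proof (cases "w = 0")
    case False
    then have "H w w \<noteq> 0" using insert.prems w by blast
    moreover have "H (u - s) w = H (u - p) w - H (u - p) w / H w w * H w w"
      by (simp add: s_def add_left diff_left scale_left)
    ultimately show ?thesis by simp
  qed simp
  have H_b: "H (u - s) b = 0"
    using H_w H_B[OF r(1)] by (simp add: w_def diff_right)
  have "\<forall>c\<in>cvec.span (insert b B). H (u - s) c = 0"
    using orthogonal_span[of _ "insert b B" "u - s"] H_b H_B cvec.span_base by blast
  with sB show ?case by blast
qed

text \<open>Independence is asked of the indexed family: \<open>x k\<close> is outside the span of
  any subfamily without \<open>k\<close>. This excludes repetitions and passes to smaller index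
  sets, as the induction requires.\<close>

lemma gram_schmidt:
  fixes x :: "'i \<Rightarrow> cvec"
  assumes "finite J" "\<And>y. y \<in> cvec.span (x ` J) \<Longrightarrow> y \<noteq> 0 \<Longrightarrow> 0 < Re (H y y)"
    "\<And>K k. K \<subseteq> J \<Longrightarrow> k \<in> J - K \<Longrightarrow> x k \<notin> cvec.span (x ` K)"
  shows "\<exists>f. f ` J \<subseteq> cvec.span (x ` J) \<and> (\<forall>i\<in>J. \<forall>j\<in>J. H (f i) (f j) = (if i = j then 1 else 0))"
  using assms
proof (induction J rule: finite_induct)
  case empty
  then show ?case by simp
next
  case (insert k J)
  have mono: "y \<in> cvec.span (x ` J) \<Longrightarrow> y \<in> cvec.span (x ` insert k J)" for y
    using cvec.span_mono[of "x ` J" "x ` insert k J"] by auto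
  have "\<exists>f. f ` J \<subseteq> cvec.span (x ` J) \<and> (\<forall>i\<in>J. \<forall>j\<in>J. H (f i) (f j) = (if i = j then 1 else 0))"
    using insert.prems mono by (intro insert.IH) blast+
  then obtain f where f: "f ` J \<subseteq> cvec.span (x ` J)"
    and fH: "\<And>i j. i \<in> J \<Longrightarrow> j \<in> J \<Longrightarrow> H (f i) (f j) = (if i = j then 1 else 0)" by blast
  have "\<exists>p\<in>cvec.span (x ` J). \<forall>b\<in>cvec.span (x ` J). H (x k - p) b = 0"
  proof (rule projection_exists)
    show "finite (x ` J)" using insert.hyps by simp
    fix y assume "y \<in> cvec.span (x ` J)" "y \<noteq> 0"
    then have "0 < Re (H y y)" using insert.prems(1) mono by blast
    then show "H y y \<noteq> 0" by auto
  qed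
  then obtain p where p: "p \<in> cvec.span (x ` J)" "\<And>b. b \<in> cvec.span (x ` J) \<Longrightarrow> H (x k - p) b = 0"
    by blast
  define y where "y = x k - p"
  have "x k \<notin> cvec.span (x ` J)" using insert.prems(2)[of J k] insert.hyps by blast
  then have "y \<noteq> 0" using p(1) by (auto simp: y_def)
  moreover have yspan: "y \<in> cvec.span (x ` insert k J)"
    unfolding y_def by (intro cvec.span_diff mono p(1) cvec.span_base) simp
  ultimately have pos: "0 < Re (H y y)" using insert.prems by blast
  define s where "s = 1 / sqrt (Re (H y y))"
  define z where "z = cscale (of_real s) y"
  have "H z z = of_real (s * s * Re (H y y))"
    by (simp add: z_def scale_left scale_right flip: self_real)
  also have "s * s * Re (H y y) = 1"
    using pos by (simp add: s_def)
  finally have zz: "H z z = 1" by simp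
  have zf: "H z (f j) = 0" if "j \<in> J" for j
    using p(2)[of "f j"] f that by (auto simp: z_def y_def scale_left)
  then have fz: "H (f j) z = 0" if "j \<in> J" for j
    using that cnj_commute[of z "f j"] by simp
  define f' where "f' = f(k := z)"
  have "f' ` insert k J \<subseteq> cvec.span (x ` insert k J)"
    using f mono yspan insert.hyps by (auto simp: f'_def z_def intro!: cvec.span_scale)
  moreover have "\<forall>i\<in>insert k J. \<forall>j\<in>insert k J. H (f' i) (f' j) = (if i = j then 1 else 0)"
    using insert.hyps zz zf fz fH by (auto simp: f'_def)
  ultimately show ?case by blast
qed

text \<open>Pairing a vanishing combination with \<open>f k\<close> isolates the coefficient of
  \<open>f k\<close>. The squares \<open>c i\<close> may have either sign, which covers families of
  mixed type for \<open>herm\<close>.\<close>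

lemma orthogonal_independent:
  assumes "finite I" "\<And>i j. i \<in> I \<Longrightarrow> j \<in> I \<Longrightarrow> H (f i) (f j) = (if i = j then c i else 0)"
    "\<And>i. i \<in> I \<Longrightarrow> c i \<noteq> 0"
  shows "inj_on f I" "cvec.independent (f ` I)"
proof -
  show inj: "inj_on f I"
    by (rule inj_onI) (metis assms(2,3))
  show "cvec.independent (f ` I)"
  proof (rule cvec.independent_if_scalars_zero)
    show "finite (f ` I)" using assms(1) by simp
  next
    fix u y assume 0: "(\<Sum>x\<in>f ` I. cscale (u x) x) = 0" and "y \<in> f ` I"
    then obtain k where k: "k \<in> I" "y = f k" by auto
    have "0 = H (\<Sum>x\<in>f ` I. cscale (u x) x) (f k)" using 0 by simp
    also have "\<dots> = (\<Sum>i\<in>I. u (f i) * H (f i) (f k))"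
      by (simp add: sum.reindex[OF inj] sum_left scale_left)
    also have "\<dots> = u (f k) * c k"
      using k assms(1) by (simp add: assms(2) if_distrib cong: if_cong)
    finally show "u y = 0" using k assms(3) by auto
  qed
qed

text \<open>A count: \<open>f\<close> gives \<open>card I\<close> independent vectors inside a span
  of at most \<open>card I\<close> vectors, so no vector of that span can be independent of them.
  This is the source of surjectivity of isometries.\<close>

lemma orthogonal_spans:
  assumes "finite I" "\<And>i j. i \<in> I \<Longrightarrow> j \<in> I \<Longrightarrow> H (f i) (f j) = (if i = j then c i else 0)"
    "\<And>i. i \<in> I \<Longrightarrow> c i \<noteq> 0" "f ` I \<subseteq> cvec.span (x ` I)"
  shows "cvec.span (x ` I) \<subseteq> cvec.span (f ` I)"
proof -
  have ind: "inj_on f I" "cvec.independent (f ` I)"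
    by (rule orthogonal_independent[of I f c]; use assms in simp)+
  have "x i \<in> cvec.span (f ` I)" if "i \<in> I" for i
  proof (rule ccontr)
    assume i: "x i \<notin> cvec.span (f ` I)"
    have "insert (x i) (f ` I) \<subseteq> cvec.span (x ` I)"
      using that assms(4) by (auto intro: cvec.span_base)
    then have "card (insert (x i) (f ` I)) \<le> card (x ` I)"
      by (rule cvec.independent_span_bound[OF finite_imageI[OF assms(1)]
          cvec.independent_insertI[OF i ind(2)], THEN conjunct2])
    moreover have "x i \<notin> f ` I" using i cvec.span_base by blast
    ultimately show False
      using card_image[OF ind(1)] card_image_le[OF assms(1), of x] assms(1) by simp
  qed
  then show ?thesis
    by (intro cvec.span_minimal) auto
qed

end

section \<open>The forms \<open>ip\<close> and \<open>herm\<close> and the projections they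
  define\<close>

definition sgn_idx :: "int \<Rightarrow> complex" where
  "sgn_idx i = (if i < 0 then 1 else - 1)"

lemma ip_sum:
  assumes "finite A" "x \<in> supp A"
  shows "ip x y = (\<Sum>i\<in>A. lk x i * cnj (lk y i))"
  unfolding ip_def
  by (rule sum.mono_neutral_left) (use assms in \<open>auto simp: supp_def in_keys_iff\<close>)

lemma herm_sum:
  assumes "finite A" "x \<in> supp A"
  shows "herm x y = (\<Sum>i\<in>A. sgn_idx i * lk x i * cnj (lk y i))"
  unfolding herm_def sgn_idx_def
  by (rule sum.mono_neutral_left) (use assms in \<open>auto simp: supp_def in_keys_iff\<close>)

interpretation ip: hermitian_form ip
proof
  fix x y z :: cvec and c
  let ?A = "Poly_Mapping.keys x \<union> Poly_Mapping.keys y"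
  have s: "x + y \<in> supp ?A" "x \<in> supp ?A" "y \<in> supp ?A" "cscale c x \<in> supp ?A"
    by (auto simp: supp_iff lookup_add in_keys_iff)
  show "ip (x + y) z = ip x z + ip y z"
    using s by (simp add: ip_sum[of ?A] lookup_add sum.distrib algebra_simps)
  show "ip (cscale c x) z = c * ip x z"
    using s by (simp add: ip_sum[of ?A] sum_distrib_left algebra_simps)
  show "cnj (ip x y) = ip y x"
    using s by (simp add: ip_sum[of ?A] cnj_sum algebra_simps)
qed

interpretation herm: hermitian_form herm
proof
  fix x y z :: cvec and c
  let ?A = "Poly_Mapping.keys x \<union> Poly_Mapping.keys y"
  have s: "x + y \<in> supp ?A" "x \<in> supp ?A" "y \<in> supp ?A" "cscale c x \<in> supp ?A"
    by (auto simp: supp_iff lookup_add in_keys_iff)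
  show "herm (x + y) z = herm x z + herm y z"
    using s by (simp add: herm_sum[of ?A] lookup_add sum.distrib algebra_simps)
  show "herm (cscale c x) z = c * herm x z"
    using s by (simp add: herm_sum[of ?A] sum_distrib_left algebra_simps)
  have "cnj (sgn_idx i) = sgn_idx i" for i by (simp add: sgn_idx_def)
  then show "cnj (herm x y) = herm y x"
    using s by (simp add: herm_sum[of ?A] cnj_sum algebra_simps)
qed

interpretation neg_herm: hermitian_form "\<lambda>x y. - herm x y"
  by unfold_locales (simp_all add: herm.add_left herm.scale_left herm.cnj_commute)

lemma ip_self: "Re (ip x x) = (\<Sum>i\<in>Poly_Mapping.keys x. (cmod (lk x i))\<^sup>2)"
  by (simp add: ip_def complex_mult_cnj cmod_def)

lemma ip_self_nonneg: "0 \<le> Re (ip x x)"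
  by (simp add: ip_self sum_nonneg)

lemma ip_self_pos: "x \<noteq> 0 \<Longrightarrow> 0 < Re (ip x x)"
  unfolding ip_self by (rule sum_pos) (auto simp: in_keys_iff)

lemma herm_bvec: "herm (bvec i) (bvec j) = (if i = j then sgn_idx i else 0)"
  by (subst herm_sum[of "{i}"]) (auto simp: lk_bvec)

lemma herm_bvec_right: "herm x (bvec j) = sgn_idx j * lk x j"
  by (subst herm_sum[of "insert j (Poly_Mapping.keys x)"])
    (auto simp: lk_bvec if_distrib supp_def cong: if_cong)

lemma herm_plus: "x \<in> V_plus \<Longrightarrow> herm x y = ip x y"
  by (auto simp: herm_def ip_def V_plus_eq supp_def intro!: sum.cong)

lemma herm_minus: "x \<in> V_minus q \<Longrightarrow> herm x y = - ip x y"
  by (force simp: herm_def ip_def V_minus_eq supp_def sum_negf[symmetric] dest: pos_idx_pos intro!: sum.cong)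

lemma ip_disjoint: "x \<in> supp S \<Longrightarrow> y \<in> supp T \<Longrightarrow> S \<inter> T = {} \<Longrightarrow> ip x y = 0"
  unfolding ip_def by (rule sum.neutral) (auto simp: supp_iff in_keys_iff)

lemma ip_plus_minus: "x \<in> V_plus \<Longrightarrow> y \<in> V_minus q \<Longrightarrow> ip x y = 0"
  using neg_pos_disjoint[of q] by (simp add: V_plus_eq V_minus_eq ip_disjoint)

lemma ip_minus_plus: "x \<in> V_minus q \<Longrightarrow> y \<in> V_plus \<Longrightarrow> ip x y = 0"
  using ip_plus_minus[of y x q] ip.cnj_commute[of y x] by simp

lemma herm_split:
  assumes "u \<in> V_plus" "u' \<in> V_plus" "v \<in> V_minus q" "v' \<in> V_minus q"
  shows "herm (v + u) (v' + u') = ip u u' - ip v v'"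
  using assms by (simp add: herm.add_left ip.add_right herm_plus herm_minus[OF assms(3)]
      ip_plus_minus ip_minus_plus)

text \<open>On \<open>supp S\<close> the form is a nonzero multiple of \<open>ip\<close>, and
  definiteness of \<open>ip\<close> makes the projection in the description unique. The factor
  \<open>e\<close> covers \<open>V_+\<close> and \<open>V_-\<close> together.\<close>

lemma herm_proj_supp:
  assumes "\<And>x y. x \<in> supp S \<Longrightarrow> herm x y = e * ip x y" "e \<noteq> 0"
  shows "herm_proj (supp S) x = restr S x"
  unfolding herm_proj_def
proof (rule the_equality)
  \<comment> \<open>\<open>herm_proj\<close> puts the vector of the subspace in the second argument,
    whereas the assumption concerns the first.\<close>
  have e: "herm x z = cnj e * ip x z" if "z \<in> supp S" for x z
    using arg_cong[OF assms(1)[OF that, of x], of cnj]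
    by (simp only: complex_cnj_mult herm.cnj_commute ip.cnj_commute)
  have orth: "ip (x - restr S x) z = 0" if "z \<in> supp S" for z
  proof -
    have "x - restr S x \<in> supp (- S)" by (simp add: supp_iff lk_minus lk_restr)
    then show ?thesis using that by (simp add: ip_disjoint[of _ "- S" _ S])
  qed
  show "restr S x \<in> supp S \<and> (\<forall>z\<in>supp S. herm (x - restr S x) z = 0)"
    by (simp add: restr_supp e orth)
  fix y assume y: "y \<in> supp S \<and> (\<forall>z\<in>supp S. herm (x - y) z = 0)"
  define z where "z = restr S x - y"
  have z: "z \<in> supp S"
    using y by (auto simp: z_def intro: cvec.subspace_diff[OF subspace_supp] restr_supp)
  have "ip (x - y) z = 0" using y z e[OF z, of "x - y"] assms(2) by simp
  moreover have "x - y = (x - restr S x) + z" by (simp add: z_def)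
  ultimately have "ip z z = 0" using orth[OF z] by (metis ip.add_left add_0)
  then have "z = 0" using ip_self_pos[of z] by auto
  then show "y = restr S x" by (simp add: z_def)
qed

lemma \<pi>_plus_eq: "\<pi>_plus x = restr neg_idx x"
  unfolding V_plus_eq by (rule herm_proj_supp[of _ 1]) (simp_all add: herm_plus V_plus_eq)

lemma \<pi>_minus_eq: "\<pi>_minus q x = restr (pos_idx q) x"
  unfolding V_minus_eq
  by (rule herm_proj_supp[of _ "- 1"]) (simp_all add: herm_minus[of _ q] V_minus_eq)

section \<open>Determinants of finitary matrices\<close>

text \<open>The Leibniz formula of \<open>fin_det\<close> with a free index set, because block
  computations use a finite set that may exceed the moved indices.\<close>

definition det_on :: "int set \<Rightarrow> (int \<Rightarrow> int \<Rightarrow> complex) \<Rightarrow> complex" where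
  "det_on S M = (\<Sum>p | p permutes S. of_int (sign p) * (\<Prod>i\<in>S. M i (p i)))"

lemma det_on_cong:
  assumes "\<And>i j. i \<in> S \<Longrightarrow> j \<in> S \<Longrightarrow> M i j = N i j"
  shows "det_on S M = det_on S N"
proof -
  have "(\<Prod>i\<in>S. M i (p i)) = (\<Prod>i\<in>S. N i (p i))" if "p permutes S" for p
    using assms permutes_in_image[OF that] by (intro prod.cong) auto
  then show ?thesis by (simp add: det_on_def)
qed

text \<open>Conjugation by an enumeration of \<open>S\<close> matches the permutations of
  \<open>{0..<n}\<close> with those of \<open>S\<close> and keeps their signs. This gives access to
  multiplicativity and transposition of matrix determinants.\<close>

lemma det_on_eq_det:
  assumes "bij_betw \<phi> {0..<n} S"
  shows "det_on S M = Determinant.det (Matrix.mat n n (\<lambda>(i, j). M (\<phi> i) (\<phi> j)))"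
proof -
  let ?U = "{0..<n}"
  let ?\<psi> = "inv_into ?U \<phi>"
  have inj: "inj_on \<phi> ?U" using assms by (simp add: bij_betw_def)
  have bij': "bij_betw ?\<psi> S ?U" using assms by (rule bij_betw_inv_into)
  have right: "\<phi> (?\<psi> x) = x" if "x \<in> S" for x
    using assms that by (simp add: bij_betw_inv_into_right)
  have left: "?\<psi> (\<phi> x) = x" if "x \<in> ?U" for x
    using assms that by (simp add: bij_betw_inv_into_left)
  have "(\<Sum>p | p permutes ?U. of_int (sign p) * (\<Prod>i\<in>?U. M (\<phi> i) (\<phi> (p i)))) =
      (\<Sum>p | p permutes S. of_int (sign p) * (\<Prod>i\<in>S. M i (p i)))"
  proof (rule sum.reindex_bij_witness[where i = "map_permutation S ?\<psi>" and j = "map_permutation ?U \<phi>"])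
    fix p assume "p \<in> {p. p permutes ?U}"
    then have p: "p permutes ?U" by simp
    show "map_permutation ?U \<phi> p \<in> {p. p permutes S}"
      using map_permutation_permutes[OF assms p] by simp
    show "map_permutation S ?\<psi> (map_permutation ?U \<phi> p) = p"
      by (rule map_permutation_compose_inv[OF assms p]) (rule left)
    have "(\<Prod>i\<in>S. M i (map_permutation ?U \<phi> p i)) = (\<Prod>i\<in>?U. M (\<phi> i) (map_permutation ?U \<phi> p (\<phi> i)))"
      by (rule prod.reindex_bij_betw[OF assms, symmetric])
    also have "\<dots> = (\<Prod>i\<in>?U. M (\<phi> i) (\<phi> (p i)))"
      by (rule prod.cong) (auto simp: map_permutation_apply[OF inj])
    finally show "of_int (sign (map_permutation ?U \<phi> p)) * (\<Prod>i\<in>S. M i (map_permutation ?U \<phi> p i)) =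
        (of_int (sign p) * (\<Prod>i\<in>?U. M (\<phi> i) (\<phi> (p i))) :: complex)"
      by (simp add: sign_map_permutation[OF inj p])
  next
    fix p assume "p \<in> {p. p permutes S}"
    then have p: "p permutes S" by simp
    show "map_permutation S ?\<psi> p \<in> {p. p permutes ?U}"
      using map_permutation_permutes[OF bij' p] by simp
    show "map_permutation ?U \<phi> (map_permutation S ?\<psi> p) = p"
      by (rule map_permutation_compose_inv[OF bij' p]) (rule right)
  qed
  moreover have "(\<Prod>i\<in>?U. Matrix.mat n n (\<lambda>(i, j). M (\<phi> i) (\<phi> j)) $$ (i, p i)) =
      (\<Prod>i\<in>?U. M (\<phi> i) (\<phi> (p i)))" if "p permutes ?U" for p
  proof (rule prod.cong)
    fix i assume i: "i \<in> ?U"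
    then have "p i \<in> ?U" using permutes_in_image[OF that] by blast
    then show "Matrix.mat n n (\<lambda>(i, j). M (\<phi> i) (\<phi> j)) $$ (i, p i) = M (\<phi> i) (\<phi> (p i))"
      using i by simp
  qed simp
  ultimately show ?thesis
    unfolding det_on_def by (subst det_def'[of _ n]) simp_all
qed

text \<open>The hypothesis on the columns says \<open>A\<^sup>T J A' = J\<close>, with
  \<open>A'\<close> the entrywise conjugate of \<open>A\<close> and \<open>J\<close> the diagonal
  matrix of the signs. Taking determinants and cancelling that of \<open>J\<close> leaves a
  determinant of modulus one.\<close>

lemma det_on_isometry:
  assumes "finite S"
    and orth: "\<And>a b. a \<in> S \<Longrightarrow> b \<in> S \<Longrightarrow>
      (\<Sum>i\<in>S. \<epsilon> i * M i a * cnj (M i b)) = (if a = b then \<epsilon> a else 0)"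
    and \<epsilon>: "\<And>i. i \<in> S \<Longrightarrow> \<epsilon> i * \<epsilon> i = 1"
  shows "det_on S M * cnj (det_on S M) = 1"
proof -
  obtain \<phi> where \<phi>: "bij_betw \<phi> {0..<card S} S"
    using ex_bij_betw_nat_finite[OF assms(1)] by blast
  define n where "n = card S"
  note \<phi> = \<phi>[folded n_def]
  have \<phi>S: "\<phi> i \<in> S" if "i < n" for i using bij_betwE[OF \<phi>] that by simp
  have \<phi>inj: "\<phi> i = \<phi> j \<longleftrightarrow> i = j" if "i < n" "j < n" for i j
    using \<phi> that by (auto simp: bij_betw_def inj_on_def)
  define A where "A = Matrix.mat n n (\<lambda>(i, j). M (\<phi> i) (\<phi> j))"
  define J where "J = Matrix.mat n n (\<lambda>(i, j). if i = j then \<epsilon> (\<phi> i) else 0)"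
  have A: "A \<in> carrier_mat n n" and J: "J \<in> carrier_mat n n" by (simp_all add: A_def J_def)
  have dA: "Determinant.det A = det_on S M"
    by (simp add: A_def det_on_eq_det[OF \<phi>])
  interpret cnj: comm_ring_hom cnj by unfold_locales simp_all
  \<comment> \<open>\<open>J\<close> is an involution, so its determinant is nonzero.\<close>
  have JJ: "J * J = 1\<^sub>m n"
  proof (rule eq_matI)
    fix a b assume "a < dim_row (1\<^sub>m n :: complex mat)" "b < dim_col (1\<^sub>m n :: complex mat)"
    then have ab: "a < n" "b < n" by simp_all
    have "(J * J) $$ (a, b) = (\<Sum>i\<in>{0..<n}. J $$ (a, i) * J $$ (i, b))"
      using ab J by (simp add: scalar_prod_def)
    also have "\<dots> = (\<Sum>i\<in>{0..<n}. if i = a then (if a = b then 1 else 0) else 0)"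
    proof (rule sum.cong)
      fix i assume "i \<in> {0..<n}"
      then show "J $$ (a, i) * J $$ (i, b) = (if i = a then (if a = b then 1 else 0) else 0)"
        using ab \<epsilon>[OF \<phi>S[OF ab(1)]] \<epsilon>[OF \<phi>S[OF ab(2)]] by (simp add: J_def)
    qed simp
    finally show "(J * J) $$ (a, b) = 1\<^sub>m n $$ (a, b)" using ab by simp
  qed (use J in auto)
  have "Determinant.det J * Determinant.det J = 1"
    using det_mult[OF J J] JJ by simp
  then have dJ: "Determinant.det J \<noteq> 0" by auto
  have AJ: "A\<^sup>T * J * map_mat cnj A = J"
  proof (rule eq_matI)
    fix a b assume "a < dim_row J" "b < dim_col J"
    then have ab: "a < n" "b < n" by (simp_all add: J_def)
    have 1: "(A\<^sup>T * J) $$ (a, i) = M (\<phi> i) (\<phi> a) * \<epsilon> (\<phi> i)" if "i < n" for i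
    proof -
      have "(A\<^sup>T * J) $$ (a, i) = (\<Sum>k\<in>{0..<n}. A $$ (k, a) * J $$ (k, i))"
        using ab that A J by (simp add: scalar_prod_def)
      also have "\<dots> = (\<Sum>k\<in>{0..<n}. if k = i then M (\<phi> i) (\<phi> a) * \<epsilon> (\<phi> i) else 0)"
        by (rule sum.cong) (use ab that in \<open>auto simp: A_def J_def\<close>)
      finally show ?thesis using that by simp
    qed
    have mult_index: "(B * C) $$ (a, b) = (\<Sum>i\<in>{0..<n}. B $$ (a, i) * C $$ (i, b))"
      if "B \<in> carrier_mat n n" "C \<in> carrier_mat n n" for B C :: "complex mat"
      using ab that by (simp add: scalar_prod_def)
    have "(A\<^sup>T * J * map_mat cnj A) $$ (a, b) =
        (\<Sum>i\<in>{0..<n}. (A\<^sup>T * J) $$ (a, i) * map_mat cnj A $$ (i, b))"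
      by (rule mult_index) (use A J in auto)
    also have "\<dots> = (\<Sum>i\<in>{0..<n}. \<epsilon> (\<phi> i) * M (\<phi> i) (\<phi> a) * cnj (M (\<phi> i) (\<phi> b)))"
      by (rule sum.cong) (use ab 1 in \<open>auto simp: A_def\<close>)
    also have "\<dots> = (\<Sum>i\<in>S. \<epsilon> i * M i (\<phi> a) * cnj (M i (\<phi> b)))"
      by (rule sum.reindex_bij_betw[OF \<phi>])
    also have "\<dots> = J $$ (a, b)"
      using ab \<phi>S \<phi>inj by (simp add: orth J_def)
    finally show "(A\<^sup>T * J * map_mat cnj A) $$ (a, b) = J $$ (a, b)" .
  qed (use A J in auto)
  have "Determinant.det (A\<^sup>T * J * map_mat cnj A) =
      Determinant.det A * Determinant.det J * cnj (Determinant.det A)"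
    using A J by (simp add: det_mult[of _ n] Determinant.det_transpose[OF A] cnj.hom_det)
  then show ?thesis
    using dJ AJ dA by (simp add: field_simps)
qed

text \<open>A permutation meets column \<open>k\<close> exactly once, so the factor comes out of
  every summand of the Leibniz formula.\<close>

lemma det_on_scale_col:
  assumes "finite S" "k \<in> S"
  shows "det_on S (\<lambda>i j. if j = k then c * M i j else M i j) = c * det_on S M"
proof -
  have "(\<Prod>i\<in>S. if p i = k then c * M i (p i) else M i (p i)) = c * (\<Prod>i\<in>S. M i (p i))"
    if p: "p permutes S" for p
  proof -
    have "(\<Prod>i\<in>S. if p i = k then c * M i (p i) else M i (p i)) =
        (\<Prod>i\<in>S. (if p i = k then c else 1) * M i (p i))"
      by (rule prod.cong) auto
    also have "\<dots> = (\<Prod>i\<in>S. if p i = k then c else 1) * (\<Prod>i\<in>S. M i (p i))"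
      by (rule prod.distrib)
    also have "(\<Prod>i\<in>S. if p i = k then c else 1) = (\<Prod>i\<in>S. if i = k then c else 1)"
      using prod.permute[OF p, of "\<lambda>i. if i = k then c else 1"] by (simp add: o_def)
    also have "\<dots> = c" using assms by simp
    finally show ?thesis .
  qed
  then show ?thesis
    by (simp add: det_on_def sum_distrib_left mult_ac)
qed

text \<open>The column of a fixed basis vector is a unit vector. So a permutation that moves a fixed
  index contributes zero, and the others pick up only factors \<open>1\<close> outside
  \<open>moved q g\<close>.\<close>

lemma fin_det_eq_det_on:
  assumes "finite S" "moved q g \<subseteq> S" "S \<subseteq> idx q"
  shows "fin_det q g = det_on S (entry g)"
proof -
  have fixed: "entry g i j = (if i = j then 1 else 0)" if "j \<in> S - moved q g" for i j
    using that assms(3) by (auto simp: moved_def entry_def lk_bvec)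
  have "(\<Sum>p | p permutes moved q g. of_int (sign p) * (\<Prod>i\<in>S. entry g i (p i))) =
      (\<Sum>p | p permutes S. of_int (sign p) * (\<Prod>i\<in>S. entry g i (p i)))"
  proof (rule sum.mono_neutral_left)
    show "finite {p. p permutes S}" using assms(1) by (rule finite_permutations)
    show "{p. p permutes moved q g} \<subseteq> {p. p permutes S}"
      using assms(2) by (auto intro: permutes_subset)
    show "\<forall>p\<in>{p. p permutes S} - {p. p permutes moved q g}.
        of_int (sign p) * (\<Prod>i\<in>S. entry g i (p i)) = 0"
    proof
      fix p assume "p \<in> {p. p permutes S} - {p. p permutes moved q g}"
      then have p: "p permutes S" "\<not> p permutes moved q g" by auto
      then obtain j where j: "j \<in> S - moved q g" "p j \<noteq> j"
        using permutes_superset by blast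
      \<comment> \<open>\<open>i\<close> is the row paired with column \<open>j\<close>. As
        \<open>p\<close> moves \<open>j\<close>, that entry lies off the diagonal in a unit
        column.\<close>
      define i where "i = Hilbert_Choice.inv p j"
      have "p i = j" using p(1) by (simp add: i_def permutes_inverses)
      moreover have "i \<in> S" using p(1) j(1) permutes_in_image[OF permutes_inv[OF p(1)]] by (auto simp: i_def)
      moreover have "i \<noteq> j" using \<open>p i = j\<close> j(2) by auto
      ultimately have "i \<in> S" "entry g i (p i) = 0" using fixed[OF j(1), of i] by simp_all
      then have "(\<Prod>i\<in>S. entry g i (p i)) = 0" using assms(1) prod_zero_iff by blast
      then show "of_int (sign p) * (\<Prod>i\<in>S. entry g i (p i)) = 0" by simp
    qed
  qed
  moreover have "(\<Prod>i\<in>moved q g. entry g i (p i)) = (\<Prod>i\<in>S. entry g i (p i))"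
    if "p permutes moved q g" for p
  proof (rule prod.mono_neutral_left)
    show "\<forall>i\<in>S - moved q g. entry g i (p i) = 1"
      using fixed permutes_not_in[OF that] by simp
  qed (use assms in auto)
  ultimately show ?thesis
    by (simp add: fin_det_def det_on_def)
qed

section \<open>Isometries and contractions\<close>

lemma lin_cong: "x \<in> supp S \<Longrightarrow> (\<And>i. i \<in> S \<Longrightarrow> b i = c i) \<Longrightarrow> lin b x = lin c x"
  unfolding lin_def supp_def by (rule sum.cong) auto

lemma lin_id: "lin bvec x = x"
  unfolding lin_def using cvec_expand[OF finite_keys keys_supp] by metis

lemma lin_add_fun: "lin (\<lambda>i. b i + c i) x = lin b x + lin c x"
  by (simp add: lin_def cvec.scale_right_distrib sum.distrib)

lemma span_image_eq_lin: "cvec.span (b ` S) = lin b ` supp S"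
proof
  have "restrict (lin b) (supp S) \<in> lin_maps (supp S) UNIV"
    using ext_lin_lin_maps[of UNIV S b] by (simp add: ext_lin_def)
  then have "cvec.subspace (restrict (lin b) (supp S) ` supp S)"
    by (rule subspace_lin_maps_image) simp
  then have "cvec.subspace (lin b ` supp S)" by simp
  moreover have "b i \<in> lin b ` supp S" if "i \<in> S" for i
    using that by (metis bvec_supp image_eqI lin_bvec)
  ultimately show "cvec.span (b ` S) \<subseteq> lin b ` supp S"
    by (intro cvec.span_minimal) auto
  show "lin b ` supp S \<subseteq> cvec.span (b ` S)"
    using lin_mem[of "cvec.span (b ` S)" S b] by (auto intro: cvec.span_base)
qed

lemma lin_maps_image_supp:
  assumes "g \<in> lin_maps (supp S) T" "K \<subseteq> S"
  shows "g ` supp K = cvec.span ((\<lambda>i. g (bvec i)) ` K)"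
  unfolding span_image_eq_lin
  by (rule image_cong) (use assms supp_mono lin_maps_eq_lin in blast)+

lemma lk_lin_maps:
  assumes "f \<in> lin_maps (supp S) T" "x \<in> supp S"
  shows "lk (f x) k = (\<Sum>j\<in>Poly_Mapping.keys x. lk x j * entry f k j)"
  by (simp add: lin_maps_eq_lin[OF assms] lin_def lk_sum entry_def)

lemma herm_lin:
  assumes "\<And>i j. i \<in> S \<Longrightarrow> j \<in> S \<Longrightarrow> herm (b i) (b j) = herm (bvec i) (bvec j)"
    "x \<in> supp S" "y \<in> supp S"
  shows "herm (lin b x) (lin b y) = herm x y"
proof -
  have "herm (lin b x) (lin b y) = herm (lin bvec x) (lin bvec y)"
    unfolding lin_def herm.sum_left herm.sum_right herm.scale_left herm.scale_right
    by (intro sum.cong refl arg_cong2[where f = "(*)"] assms(1))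
      (use assms(2,3) in \<open>auto simp: supp_def\<close>)
  then show ?thesis by (simp add: lin_id)
qed

lemma bvec_V_plus [simp]: "bvec i \<in> V_plus \<longleftrightarrow> i < 0"
  and bvec_V_minus [simp]: "bvec i \<in> V_minus q \<longleftrightarrow> i \<in> pos_idx q"
  and bvec_Vsp [simp]: "bvec i \<in> Vsp q \<longleftrightarrow> i \<in> idx q"
  by (simp_all add: V_plus_eq V_minus_eq Vsp_eq)

text \<open>What bijectivity, the norm bound and preservation of maximality rest on;
  \<open>SU\<close> adds the determinant, which is dealt with separately.\<close>

definition isom :: "enat \<Rightarrow> (cvec \<Rightarrow> cvec) \<Rightarrow> bool" where
  "isom q g \<longleftrightarrow> g \<in> lin_maps (Vsp q) (Vsp q) \<and> finite (moved q g) \<and>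
     (\<forall>x\<in>Vsp q. \<forall>y\<in>Vsp q. herm (g x) (g y) = herm x y)"

lemma SU_iff: "g \<in> SU q \<longleftrightarrow> isom q g \<and> fin_det q g = 1"
  by (auto simp: SU_def SL_def isom_def)

lemma herm_nondegenerate:
  assumes "x \<in> Vsp q" "\<And>y. y \<in> Vsp q \<Longrightarrow> herm x y = 0"
  shows "x = 0"
proof (rule poly_mapping_eqI)
  fix i
  show "lk x i = lk 0 i"
  proof (cases "i \<in> idx q")
    case True
    then have "herm x (bvec i) = 0" by (intro assms(2)) (simp add: Vsp_eq)
    then show ?thesis by (simp add: herm_bvec_right sgn_idx_def split: if_splits)
  next
    case False
    then show ?thesis using assms(1) by (simp add: Vsp_eq supp_iff)
  qed
qed

text \<open>Injectivity is nondegeneracy of \<open>herm\<close>. For surjectivity a given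
  \<open>y\<close> is enclosed in a finite block that \<open>g\<close> maps into itself, where
  orthogonality and counting show that the images of the basis vectors span.\<close>

lemma isom_bij:
  assumes "isom q g"
  shows "bij_betw g (Vsp q) (Vsp q)"
proof -
  have g: "g \<in> lin_maps (Vsp q) (Vsp q)" and fin: "finite (moved q g)"
    and pres: "\<And>x y. x \<in> Vsp q \<Longrightarrow> y \<in> Vsp q \<Longrightarrow> herm (g x) (g y) = herm x y"
    using assms by (auto simp: isom_def)
  have "inj_on g (Vsp q)"
  proof (rule inj_onI)
    fix x y assume xy: "x \<in> Vsp q" "y \<in> Vsp q" "g x = g y"
    then have d: "x - y \<in> Vsp q" by (simp add: cvec.subspace_diff)
    have "g (x - y) = 0" using lin_maps_diff[OF g _ xy(1,2)] xy(3) by simp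
    then have "herm (x - y) z = 0" if "z \<in> Vsp q" for z
      using pres[OF d that] by simp
    then show "x = y" using herm_nondegenerate[OF d] by simp
  qed
  moreover have "y \<in> g ` Vsp q" if y: "y \<in> Vsp q" for y
  proof -
    \<comment> \<open>The indices of \<open>y\<close>, the moved indices and all that their images
      touch. Other basis vectors are fixed, so \<open>g\<close> maps \<open>supp M\<close> into
      itself.\<close>
    define M where "M = Poly_Mapping.keys y \<union> moved q g \<union> (\<Union>i\<in>moved q g. Poly_Mapping.keys (g (bvec i)))"
    have finM: "finite M" using fin by (simp add: M_def)
    have "Poly_Mapping.keys (g (bvec i)) \<subseteq> idx q" if "i \<in> moved q g" for i
    proof -
      have "g (bvec i) \<in> Vsp q" using that by (intro lin_maps_mem[OF g]) (simp add: moved_def)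
      then show ?thesis by (simp add: Vsp_eq supp_def)
    qed
    then have Mi: "M \<subseteq> idx q"
      using y by (auto simp: M_def Vsp_eq supp_def moved_def)
    have gM: "g (bvec i) \<in> supp M" if "i \<in> M" for i
    proof (cases "i \<in> moved q g")
      case True
      then show ?thesis by (auto simp: M_def supp_def)
    next
      case False
      then have "g (bvec i) = bvec i" using that Mi by (auto simp: moved_def)
      then show ?thesis using that by simp
    qed
    have eV: "bvec i \<in> Vsp q" if "i \<in> M" for i
      using that Mi by (auto simp: Vsp_eq)
    have "supp M \<subseteq> cvec.span ((\<lambda>i. g (bvec i)) ` M)"
      unfolding span_bvec[symmetric]
    proof (rule herm.orthogonal_spans[of _ _ sgn_idx, OF finM])
      fix i j assume "i \<in> M" "j \<in> M"
      then show "herm (g (bvec i)) (g (bvec j)) = (if i = j then sgn_idx i else 0)"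
        using pres[OF eV eV] by (simp add: herm_bvec)
    next
      show "(\<lambda>i. g (bvec i)) ` M \<subseteq> cvec.span (bvec ` M)"
        using gM by (auto simp: span_bvec)
    qed (simp add: sgn_idx_def)
    then have "y \<in> g ` supp M"
      using lin_maps_image_supp[OF g[unfolded Vsp_eq] Mi] by (auto simp: M_def supp_def)
    then show ?thesis using Mi supp_mono[OF Mi] by (auto simp: Vsp_eq)
  qed
  ultimately show ?thesis
    using lin_maps_mem[OF g] by (auto simp: bij_betw_def)
qed

section \<open>Finitary maps, their adjoints and contractions\<close>

lemma finitary_lin_maps: "Z \<in> finitary_maps q \<Longrightarrow> Z \<in> lin_maps (V_minus q) V_plus"
  by (simp add: finitary_maps_def)

text \<open>Every single column is a finitely supported vector, so finitariness amounts to
  finiteness of this set; see \<open>finitary_iff_cols\<close>.\<close>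

definition cols :: "enat \<Rightarrow> (cvec \<Rightarrow> cvec) \<Rightarrow> int set" where
  "cols q Z = {j \<in> pos_idx q. Z (bvec j) \<noteq> 0}"

lemma finitary_iff_cols:
  assumes "Z \<in> lin_maps (V_minus q) V_plus"
  shows "Z \<in> finitary_maps q \<longleftrightarrow> finite (cols q Z)"
proof -
  let ?E = "{(i, j). i \<in> neg_idx \<and> j \<in> pos_idx q \<and> entry Z i j \<noteq> 0}"
  have "finite ?E \<longleftrightarrow> finite (cols q Z)"
  proof
    assume "finite ?E"
    moreover have "cols q Z \<subseteq> snd ` ?E"
    proof
      fix j assume j: "j \<in> cols q Z"
      then have "Z (bvec j) \<in> V_plus" "Z (bvec j) \<noteq> 0" "j \<in> pos_idx q"
        using lin_maps_mem[OF assms] by (auto simp: cols_def)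
      then obtain i where "lk (Z (bvec j)) i \<noteq> 0" "i \<in> neg_idx"
        by (metis V_plus_eq supp_iff poly_mapping_eqI lookup_zero)
      then have "(i, j) \<in> ?E" using j by (simp add: cols_def entry_def)
      then show "j \<in> snd ` ?E" by force
    qed
    ultimately show "finite (cols q Z)" by (meson finite_imageI finite_subset)
  next
    assume f: "finite (cols q Z)"
    have "?E \<subseteq> (\<Union>j\<in>cols q Z. Poly_Mapping.keys (Z (bvec j)) \<times> {j})"
      by (auto simp: cols_def entry_def in_keys_iff)
    with f show "finite ?E" by (auto intro: finite_subset)
  qed
  then show ?thesis using assms by (simp add: finitary_maps_def)
qed

lemma finite_cols: "Z \<in> finitary_maps q \<Longrightarrow> finite (cols q Z)"
  using finitary_iff_cols finitary_lin_maps by blast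

text \<open>The conjugate transpose written out. Summing over \<open>cols q Z\<close> makes each
  conjugated row of a finitary \<open>Z\<close> a finite combination of basis vectors of
  \<open>V_-\<close>.\<close>

definition adj :: "enat \<Rightarrow> (cvec \<Rightarrow> cvec) \<Rightarrow> cvec \<Rightarrow> cvec" where
  "adj q Z = ext_lin neg_idx (\<lambda>i. \<Sum>j\<in>cols q Z. cscale (cnj (entry Z i j)) (bvec j))"

lemma adj_cols:
  assumes "u \<in> V_plus"
  shows "adj q Z u \<in> supp (cols q Z)"
  unfolding adj_def ext_lin_apply[OF assms[unfolded V_plus_eq]]
  by (rule lin_mem[OF subspace_supp _ assms[unfolded V_plus_eq]])
    (auto intro!: cvec.subspace_sum cvec.subspace_scale)

lemma adj_lin_maps: "adj q Z \<in> lin_maps V_plus (V_minus q)"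
  unfolding adj_def V_plus_eq
  by (rule ext_lin_lin_maps) (auto intro!: cvec.subspace_sum cvec.subspace_scale simp: cols_def)

lemma entry_adj:
  assumes "Z \<in> finitary_maps q" "i < 0" "j \<in> pos_idx q"
  shows "entry (adj q Z) j i = cnj (entry Z i j)"
proof -
  have "entry (adj q Z) j i = (if j \<in> cols q Z then cnj (entry Z i j) else 0)"
    using assms(2) finite_cols[OF assms(1)]
    by (simp add: entry_def adj_def ext_lin_bvec lk_sum lk_bvec if_distrib cong: if_cong)
  moreover have "entry Z i j = 0" if "j \<notin> cols q Z"
    using that assms(3) by (simp add: cols_def entry_def)
  ultimately show ?thesis by auto
qed

lemma conj_transpose_eq:
  assumes "Z \<in> finitary_maps q"
  shows "conj_transpose q Z = adj q Z"
  unfolding conj_transpose_def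
proof (rule the_equality)
  show "adj q Z \<in> lin_maps V_plus (V_minus q) \<and>
      (\<forall>i\<in>neg_idx. \<forall>j\<in>pos_idx q. entry (adj q Z) j i = cnj (entry Z i j))"
    using adj_lin_maps entry_adj[OF assms] by simp
  fix W assume W: "W \<in> lin_maps V_plus (V_minus q) \<and>
      (\<forall>i\<in>neg_idx. \<forall>j\<in>pos_idx q. entry W j i = cnj (entry Z i j))"
  show "W = adj q Z"
  proof (rule lin_maps_eqI[of _ neg_idx "V_minus q" _ "V_minus q"])
    fix i assume i: "i \<in> neg_idx"
    have "W (bvec i) \<in> V_minus q" "adj q Z (bvec i) \<in> V_minus q"
      using W i lin_maps_mem[of W V_plus "V_minus q" "bvec i"] lin_maps_mem[OF adj_lin_maps, of "bvec i" q Z]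
      by simp_all
    moreover have "lk (W (bvec i)) j = lk (adj q Z (bvec i)) j" if "j \<in> pos_idx q" for j
      using W i that entry_adj[OF assms] by (simp add: entry_def)
    ultimately show "W (bvec i) = adj q Z (bvec i)"
      by (intro poly_mapping_eqI) (metis V_minus_eq supp_iff)
  qed (use W adj_lin_maps in \<open>auto simp: V_plus_eq\<close>)
qed

lemma ip_adj:
  assumes "Z \<in> finitary_maps q" "v \<in> V_minus q" "u \<in> V_plus"
  shows "ip (Z v) u = ip v (adj q Z u)"
proof -
  note Z = finitary_lin_maps[OF assms(1)]
  have kv: "Poly_Mapping.keys v \<subseteq> pos_idx q" using assms(2) by (simp add: V_minus_eq supp_def)
  have ku: "Poly_Mapping.keys u \<subseteq> neg_idx" using assms(3) by (simp add: V_plus_eq supp_def)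
  have "ip (Z v) u = cnj (ip u (Z v))" by (simp add: ip.cnj_commute)
  also have "\<dots> = (\<Sum>i\<in>Poly_Mapping.keys u. \<Sum>j\<in>Poly_Mapping.keys v. lk v j * cnj (lk u i) * entry Z i j)"
    unfolding ip_def
    by (simp add: cnj_sum lk_lin_maps[OF Z[unfolded V_minus_eq] assms(2)[unfolded V_minus_eq]]
        sum_distrib_left mult_ac)
  also have "\<dots> = (\<Sum>j\<in>Poly_Mapping.keys v. \<Sum>i\<in>Poly_Mapping.keys u. lk v j * cnj (lk u i) * entry Z i j)"
    by (rule sum.swap)
  also have "\<dots> = (\<Sum>j\<in>Poly_Mapping.keys v. lk v j *
      cnj (\<Sum>i\<in>Poly_Mapping.keys u. lk u i * entry (adj q Z) j i))"
    unfolding cnj_sum sum_distrib_left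
  proof (intro sum.cong refl)
    fix j i assume "j \<in> Poly_Mapping.keys v" "i \<in> Poly_Mapping.keys u"
    then have "entry (adj q Z) j i = cnj (entry Z i j)"
      using ku kv by (intro entry_adj[OF assms(1)]) auto
    then show "lk v j * cnj (lk u i) * entry Z i j = lk v j * cnj (lk u i * entry (adj q Z) j i)"
      by simp
  qed
  also have "\<dots> = ip v (adj q Z u)"
    unfolding ip_def
    by (simp add: lk_lin_maps[OF adj_lin_maps[unfolded V_plus_eq] assms(3)[unfolded V_plus_eq]])
  finally show ?thesis .
qed

lemma ip_adj':
  assumes "Z \<in> finitary_maps q" "v \<in> V_minus q" "u \<in> V_plus"
  shows "ip u (Z v) = ip (adj q Z u) v"
  using ip_adj[OF assms] by (metis ip.cnj_commute)

text \<open>Moving the adjoint across turns the form of \<open>I - Z\<^sup>*Z\<close> into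
  \<open>ip v w - ip (Z v) (Z w)\<close>, in which symmetry is evident and positivity is a strict
  norm inequality.\<close>

lemma matrix_domain_iff:
  "Z \<in> matrix_domain q \<longleftrightarrow> Z \<in> finitary_maps q \<and>
     (\<forall>v\<in>V_minus q. v \<noteq> 0 \<longrightarrow> Re (ip (Z v) (Z v)) < Re (ip v v))"
proof (cases "Z \<in> finitary_maps q")
  case True
  note Z = finitary_lin_maps[OF True]
  have mem: "Z v \<in> V_plus" if "v \<in> V_minus q" for v using lin_maps_mem[OF Z that] .
  have "ip (v - adj q Z (Z v)) w = ip v w - ip (Z v) (Z w)"
    and "ip v (w - adj q Z (Z w)) = ip v w - ip (Z v) (Z w)"
    if "v \<in> V_minus q" "w \<in> V_minus q" for v w
    using that mem by (simp_all add: ip.diff_left ip.diff_right ip_adj[OF True, symmetric] ip_adj'[OF True, symmetric])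
  then show ?thesis
    using True by (auto simp: matrix_domain_def positive_definite_on_def conj_transpose_eq)
qed (simp add: matrix_domain_def)

lemma matrix_domain_finitary: "Z \<in> matrix_domain q \<Longrightarrow> Z \<in> finitary_maps q"
  and matrix_domain_lin_maps: "Z \<in> matrix_domain q \<Longrightarrow> Z \<in> lin_maps (V_minus q) V_plus"
  and matrix_domain_contraction:
    "Z \<in> matrix_domain q \<Longrightarrow> v \<in> V_minus q \<Longrightarrow> v \<noteq> 0 \<Longrightarrow> Re (ip (Z v) (Z v)) < Re (ip v v)"
  by (simp_all add: matrix_domain_iff finitary_lin_maps)

text \<open>For \<open>w = Z\<^sup>* u\<close>, expanding the square gives \<open>0 \<le> |Z w -
  u|\<^sup>2 = |Z w|\<^sup>2 - 2 |w|\<^sup>2 + |u|\<^sup>2\<close>, and \<open>|Z w| < |w|\<close>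
  turns this into \<open>|w| < |u|\<close>. The case \<open>w = 0\<close> is separate because that
  strict inequality requires a nonzero \<open>w\<close>.\<close>

lemma adj_contraction:
  assumes "Z \<in> matrix_domain q" "u \<in> V_plus" "u \<noteq> 0"
  shows "Re (ip (adj q Z u) (adj q Z u)) < Re (ip u u)"
proof (cases "adj q Z u = 0")
  case True
  then show ?thesis using ip_self_pos[OF assms(3)] by simp
next
  case False
  define w where "w = adj q Z u"
  have w: "w \<in> V_minus q" using lin_maps_mem[OF adj_lin_maps assms(2)] by (simp add: w_def)
  have "ip (Z w) u = ip w w" "ip u (Z w) = ip w w"
    using ip_adj[OF matrix_domain_finitary[OF assms(1)] w assms(2)]
      ip_adj'[OF matrix_domain_finitary[OF assms(1)] w assms(2)] by (simp_all add: w_def)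
  then have "Re (ip (Z w - u) (Z w - u)) = Re (ip (Z w) (Z w)) - 2 * Re (ip w w) + Re (ip u u)"
    by (simp add: ip.diff_left ip.diff_right)
  moreover have "Re (ip (Z w) (Z w)) < Re (ip w w)"
    using matrix_domain_contraction[OF assms(1) w] False by (simp add: w_def)
  ultimately show ?thesis
    using ip_self_nonneg[of "Z w - u"] by (simp add: w_def)
qed

definition graph_of :: "enat \<Rightarrow> (cvec \<Rightarrow> cvec) \<Rightarrow> cvec set" where
  "graph_of q Z = (\<lambda>v. v + Z v) ` V_minus q"

lemma subspace_graph:
  assumes "Z \<in> lin_maps (V_minus q) V_plus"
  shows "cvec.subspace (graph_of q Z)"
proof -
  have "restrict (\<lambda>v. v + Z v) (V_minus q) \<in> lin_maps (V_minus q) UNIV"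
    using assms by (auto simp: lin_maps_def cvec.subspace_add cvec.subspace_scale cvec.scale_right_distrib)
  from subspace_lin_maps_image[OF this] show ?thesis by (simp add: graph_of_def)
qed

lemma graph_neg_def:
  assumes "Z \<in> matrix_domain q"
  shows "neg_def_subspace q (graph_of q Z)"
  unfolding neg_def_subspace_def
proof (intro conjI ballI impI)
  note Z = matrix_domain_lin_maps[OF assms]
  show "cvec.subspace (graph_of q Z)" by (rule subspace_graph[OF Z])
  show "graph_of q Z \<subseteq> Vsp q"
    using lin_maps_mem[OF Z] V_plus_Vsp V_minus_Vsp by (auto simp: graph_of_def intro!: cvec.subspace_add)
  fix x assume "x \<in> graph_of q Z" "x \<noteq> 0"
  then obtain v where v: "v \<in> V_minus q" "x = v + Z v" by (auto simp: graph_of_def)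
  then have "v \<noteq> 0" using \<open>x \<noteq> 0\<close> lin_maps_zero[OF Z] by auto
  then show "Re (herm x x) < 0"
    using matrix_domain_contraction[OF assms v(1)] lin_maps_mem[OF Z v(1)] v
    by (simp add: herm_split)
qed

section \<open>Transitivity of \<open>SU(\<infinity>,q)\<close> on graphs of contractions\<close>

lemma graph_lin:
  assumes "W \<in> lin_maps (supp S) T" "u \<in> supp S" "\<And>i. i \<in> S \<Longrightarrow> x i = bvec i + W (bvec i)"
  shows "lin x u = u + W u"
proof -
  have "lin x u = lin (\<lambda>i. bvec i + W (bvec i)) u"
    by (rule lin_cong[OF assms(2)]) (rule assms(3))
  then show ?thesis
    by (simp add: lin_add_fun lin_id lin_maps_eq_lin[OF assms(1,2)])
qed

text \<open>The coordinate \<open>k\<close> tells them apart: it is \<open>1\<close> for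
  \<open>x k\<close> and \<open>0\<close> on the span, because \<open>W\<close> takes values in
  coordinates outside \<open>S\<close>. This is the independence that \<open>gram_schmidt\<close>
  asks for.\<close>

lemma graph_not_in_span:
  assumes "W \<in> lin_maps (supp S) (supp T)" "S \<inter> T = {}" "K \<subseteq> S" "k \<in> S - K"
    "\<And>i. i \<in> S \<Longrightarrow> x i = bvec i + W (bvec i)"
  shows "x k \<notin> cvec.span (x ` K)"
proof
  assume "x k \<in> cvec.span (x ` K)"
  then obtain u where u: "u \<in> supp K" "x k = lin x u" by (auto simp: span_image_eq_lin)
  have u': "u \<in> supp S" using supp_mono[OF assms(3) u(1)] .
  have W0: "lk (W y) k = 0" if "y \<in> supp S" for y
    using lin_maps_mem[OF assms(1) that] assms(2,4) by (auto simp: supp_iff)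
  have "lk (x k) k = 1"
    using assms(4,5) W0[of "bvec k"] by (simp add: lookup_add lk_bvec)
  moreover have "lk (lin x u) k = 0"
    using graph_lin[OF assms(1) u' assms(5)] W0[OF u'] u(1) assms(4)
    by (simp add: lookup_add supp_iff)
  ultimately show False using u(2) by simp
qed

lemma graph_span_eq:
  assumes "Z \<in> lin_maps (V_minus q) V_plus" "K \<subseteq> pos_idx q"
    "\<And>i. i \<in> pos_idx q \<Longrightarrow> x i = bvec i + Z (bvec i)"
  shows "cvec.span (x ` K) \<subseteq> graph_of q Z"
proof
  fix y assume "y \<in> cvec.span (x ` K)"
  then obtain v where v: "v \<in> supp K" "y = lin x v" by (auto simp: span_image_eq_lin)
  have "v \<in> supp (pos_idx q)" using supp_mono[OF assms(2) v(1)] .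
  then show "y \<in> graph_of q Z"
    using graph_lin[OF assms(1)[unfolded V_minus_eq] _ assms(3)] v(2)
    by (auto simp: graph_of_def V_minus_eq)
qed

text \<open>Scaling \<open>e\<^bsub>-1\<^esub>\<close> by a unit adjusts the determinant without changing the image of \<open>V_-\<close>.\<close>

lemma SU_from_orthonormal:
  assumes S: "finite S" "S \<subseteq> idx q" "- 1 \<in> S"
    and fS: "\<And>i. i \<in> S \<Longrightarrow> f i \<in> supp S"
    and orth: "\<And>i j. i \<in> S \<Longrightarrow> j \<in> S \<Longrightarrow> herm (f i) (f j) = (if i = j then sgn_idx i else 0)"
  obtains g where "g \<in> SU q" "\<And>i. i \<in> S \<Longrightarrow> i \<noteq> - 1 \<Longrightarrow> g (bvec i) = f i"
    "\<And>i. i \<in> idx q - S \<Longrightarrow> g (bvec i) = bvec i"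
proof -
  define M where "M = (\<lambda>i j. lk (f j) i)"
  define d where "d = det_on S M"
  have dd: "d * cnj d = 1"
    unfolding d_def
  proof (rule det_on_isometry[of _ sgn_idx, OF S(1)])
    fix a b assume ab: "a \<in> S" "b \<in> S"
    show "(\<Sum>i\<in>S. sgn_idx i * M i a * cnj (M i b)) = (if a = b then sgn_idx a else 0)"
      using herm_sum[OF S(1) fS[OF ab(1)], of "f b"] orth[OF ab] by (simp add: M_def)
  qed (simp add: sgn_idx_def)
  \<comment> \<open>Since \<open>d * cnj d = 1\<close>, the factor \<open>cnj d\<close> preserves
    the square of \<open>f (- 1)\<close> and makes the new determinant
    \<open>cnj d * d = 1\<close>.\<close>
  define b where "b = (\<lambda>i. if i = - 1 then cscale (cnj d) (f i) else if i \<in> S then f i else bvec i)"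
  have bS: "b i \<in> supp S" if "i \<in> S" for i
    using fS[OF that] that by (auto simp: b_def intro!: cvec.subspace_scale[OF subspace_supp])
  have b_out: "b i = bvec i" if "i \<notin> S" for i
    using that S(3) by (auto simp: b_def)
  have "herm (b i) (b j) = herm (bvec i) (bvec j)" for i j
  proof -
    have dd': "cnj d * d = 1" using dd by (simp add: mult.commute)
    have mixed: "herm (b i) (bvec j) = 0" if "i \<in> S" "j \<notin> S" for i j
      using bS[OF that(1)] that(2) by (simp add: herm_bvec_right supp_iff)
    consider "i \<in> S" "j \<in> S" | "i \<in> S" "j \<notin> S" | "i \<notin> S" "j \<in> S" | "i \<notin> S" "j \<notin> S" by blast
    then show ?thesis
    proof cases
      case 1
      then show ?thesis
        using dd' S(3) by (auto simp: b_def orth herm.scale_left herm.scale_right herm_bvec mult_ac)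
    next
      case 2
      then show ?thesis using mixed by (auto simp: b_out herm_bvec)
    next
      case 3
      then show ?thesis
        using mixed[OF 3(2,1)] herm.cnj_commute[of "b j" "bvec i"] by (auto simp: b_out herm_bvec)
    next
      case 4
      then show ?thesis by (simp add: b_out)
    qed
  qed
  note b_orth = this
  define g where "g = ext_lin (idx q) b"
  have gb: "g (bvec i) = b i" if "i \<in> idx q" for i
    using that by (simp add: g_def ext_lin_bvec)
  have g: "g \<in> lin_maps (Vsp q) (Vsp q)"
    unfolding g_def Vsp_eq
  proof (rule ext_lin_lin_maps)
    fix i assume "i \<in> idx q"
    then show "b i \<in> supp (idx q)"
      using b_out[of i] supp_mono[OF S(2) bS[of i]] by (cases "i \<in> S") auto
  qed simp
  have moved: "moved q g \<subseteq> S"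
  proof
    fix i assume "i \<in> moved q g"
    then show "i \<in> S" using gb[of i] b_out[of i] by (auto simp: moved_def)
  qed
  have "isom q g"
    unfolding isom_def
  proof (intro conjI ballI)
    show "finite (moved q g)" using moved S(1) by (rule finite_subset)
    fix x y assume "x \<in> Vsp q" "y \<in> Vsp q"
    then show "herm (g x) (g y) = herm x y"
      using herm_lin[of "idx q" b x y] b_orth by (simp add: g_def ext_lin_apply Vsp_eq)
  qed (rule g)
  moreover have "fin_det q g = 1"
  proof -
    have "fin_det q g = det_on S (entry g)"
      by (rule fin_det_eq_det_on[OF S(1) moved S(2)])
    also have "\<dots> = det_on S (\<lambda>i j. if j = - 1 then cnj d * M i j else M i j)"
      by (rule det_on_cong) (use S(2) gb in \<open>auto simp: entry_def b_def M_def\<close>)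
    also have "\<dots> = cnj d * d"
      unfolding d_def by (rule det_on_scale_col[OF S(1,3)])
    finally show ?thesis using dd by (simp add: mult.commute)
  qed
  ultimately have "g \<in> SU q" by (simp add: SU_iff)
  then show ?thesis
    by (rule that) (use gb S(2) b_out in \<open>auto simp: b_def\<close>)
qed

text \<open>Outside a finite block \<open>Z\<close> vanishes on the basis vectors of
  \<open>V_-\<close>, which thus already lie on the graph and can stay fixed.\<close>

lemma SU_transitive:
  assumes "Z \<in> matrix_domain q"
  obtains g where "g \<in> SU q" "g ` V_minus q = graph_of q Z"
proof -
  note Zfin = matrix_domain_finitary[OF assms]
  note Z = matrix_domain_lin_maps[OF assms]
  define W where "W = adj q Z"
  have W: "W \<in> lin_maps V_plus (V_minus q)" unfolding W_def by (rule adj_lin_maps)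
  \<comment> \<open>The columns and rows that \<open>Z\<close> uses, so that \<open>Z\<close> and
    its adjoint both respect the block. The index \<open>- 1\<close> is added because the
    determinant is corrected in that coordinate.\<close>
  define S where "S = {- 1} \<union> cols q Z \<union> (\<Union>j\<in>cols q Z. Poly_Mapping.keys (Z (bvec j)))"
  have finS: "finite S" using finite_cols[OF Zfin] by (simp add: S_def)
  have ZV: "Z (bvec j) \<in> supp neg_idx" if "j \<in> pos_idx q" for j
    using lin_maps_mem[OF Z, of "bvec j"] that by (simp add: V_plus_eq)
  have S: "S \<subseteq> idx q" "- 1 \<in> S"
    using ZV by (auto simp: S_def cols_def supp_def)
  define Sn where "Sn = S \<inter> neg_idx"
  define Sp where "Sp = S \<inter> pos_idx q"
  have Sn: "Sn \<subseteq> S" "Sn \<subseteq> neg_idx" "finite Sn" and Sp: "Sp \<subseteq> S" "Sp \<subseteq> pos_idx q" "finite Sp"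
    using finS by (auto simp: Sn_def Sp_def)
  define x where "x = (\<lambda>i. if i < 0 then bvec i + W (bvec i) else bvec i + Z (bvec i))"
  have xn: "x i = bvec i + W (bvec i)" if "i \<in> neg_idx" for i using that by (simp add: x_def)
  have xp: "x i = bvec i + Z (bvec i)" if "i \<in> pos_idx q" for i
    using pos_idx_pos[OF that] by (simp add: x_def)
  have ZS: "Z (bvec j) \<in> supp S" if "j \<in> pos_idx q" for j
  proof (cases "j \<in> cols q Z")
    case True
    then show ?thesis by (auto simp: S_def supp_def)
  next
    case False
    then show ?thesis using that by (simp add: cols_def cvec.subspace_0)
  qed
  have WS: "W u \<in> supp S" if "u \<in> V_plus" for u
    unfolding W_def by (rule supp_mono[OF _ adj_cols[OF that]]) (auto simp: S_def)
  have xS: "x i \<in> supp S" if "i \<in> S" for i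
  proof (cases "i < 0")
    case True
    then show ?thesis using that WS[of "bvec i"] xn[of i] by (simp add: cvec.subspace_add)
  next
    case False
    then have "i \<in> pos_idx q" using that S(1) by auto
    then show ?thesis using that ZS[of i] xp[of i] by (simp add: cvec.subspace_add)
  qed
  have span_n: "\<exists>u\<in>V_plus. y = u + W u" if y: "y \<in> cvec.span (x ` Sn)" for y
  proof -
    obtain u where u: "u \<in> supp Sn" "y = lin x u" using y by (auto simp: span_image_eq_lin)
    have "u \<in> supp neg_idx" using supp_mono[OF Sn(2) u(1)] .
    then show ?thesis
      using graph_lin[OF W[unfolded V_plus_eq] _ xn] u(2) by (auto simp: V_plus_eq)
  qed
  have span_p: "y \<in> graph_of q Z" if "y \<in> cvec.span (x ` Sp)" for y
    using graph_span_eq[OF Z Sp(2) xp] that by blast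
  obtain fn where fn: "fn ` Sn \<subseteq> cvec.span (x ` Sn)"
    "\<And>i j. i \<in> Sn \<Longrightarrow> j \<in> Sn \<Longrightarrow> herm (fn i) (fn j) = (if i = j then 1 else 0)"
  proof -
    have "\<exists>f. f ` Sn \<subseteq> cvec.span (x ` Sn) \<and>
        (\<forall>i\<in>Sn. \<forall>j\<in>Sn. herm (f i) (f j) = (if i = j then 1 else 0))"
    proof (rule herm.gram_schmidt[OF Sn(3)])
      fix y assume "y \<in> cvec.span (x ` Sn)" "y \<noteq> 0"
      then obtain u where u: "u \<in> V_plus" "y = u + W u" using span_n by blast
      then have "u \<noteq> 0" using \<open>y \<noteq> 0\<close> lin_maps_zero[OF W] by auto
      moreover have "W u \<in> V_minus q" using lin_maps_mem[OF W u(1)] .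
      ultimately show "0 < Re (herm y y)"
        using adj_contraction[OF assms u(1)] herm_split[OF u(1) u(1), of "W u" q "W u"]
        by (simp add: u(2) add.commute[of u] W_def)
    next
      fix K k assume "K \<subseteq> Sn" "k \<in> Sn - K"
      then show "x k \<notin> cvec.span (x ` K)"
        using Sn(2) by (intro graph_not_in_span[OF W[unfolded V_plus_eq V_minus_eq] neg_pos_disjoint])
          (auto intro: xn)
    qed
    then show ?thesis using that by blast
  qed
  obtain fp where fp: "fp ` Sp \<subseteq> cvec.span (x ` Sp)"
    "\<And>i j. i \<in> Sp \<Longrightarrow> j \<in> Sp \<Longrightarrow> - herm (fp i) (fp j) = (if i = j then 1 else 0)"
  proof -
    have "\<exists>f. f ` Sp \<subseteq> cvec.span (x ` Sp) \<and>
        (\<forall>i\<in>Sp. \<forall>j\<in>Sp. - herm (f i) (f j) = (if i = j then 1 else 0))"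
    proof (rule neg_herm.gram_schmidt[OF Sp(3)])
      fix y assume "y \<in> cvec.span (x ` Sp)" "y \<noteq> 0"
      then show "0 < Re (- herm y y)"
        using span_p graph_neg_def[OF assms] by (simp add: neg_def_subspace_def)
    next
      fix K k assume "K \<subseteq> Sp" "k \<in> Sp - K"
      then show "x k \<notin> cvec.span (x ` K)"
        using Sp(2) neg_pos_disjoint[of q]
        by (intro graph_not_in_span[OF Z[unfolded V_plus_eq V_minus_eq]]) (auto intro: xp)
    qed
    then show ?thesis using that by blast
  qed
  define f where "f = (\<lambda>i. if i < 0 then fn i else fp i)"
  have f_n: "f i = fn i" if "i \<in> Sn" for i using that Sn(2) by (auto simp: f_def)
  have f_p: "f i = fp i" if "i \<in> Sp" for i using that Sp(2) pos_idx_pos by (force simp: f_def)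
  have S_cases: "i \<in> Sn \<or> i \<in> Sp" if "i \<in> S" for i
    using that S(1) by (auto simp: Sn_def Sp_def)
  \<comment> \<open>Orthogonality of the two graphs is the adjoint identity
    \<open>ip (Z v) u = ip v (W u)\<close>: the opposite signs of \<open>herm\<close> on
    \<open>V_+\<close> and \<open>V_-\<close> make the two terms cancel.\<close>
  have orth_pn: "herm (fp i) (fn j) = 0" if ij: "i \<in> Sp" "j \<in> Sn" for i j
  proof -
    obtain u where u: "u \<in> V_plus" "fn j = u + W u" using fn(1) span_n ij(2) by blast
    obtain v where v: "v \<in> V_minus q" "fp i = v + Z v"
      using fp(1) span_p ij(1) by (fastforce simp: graph_of_def)
    have "herm (v + Z v) (W u + u) = ip (Z v) u - ip v (W u)"
      using lin_maps_mem[OF Z v(1)] lin_maps_mem[OF W u(1)] u(1) v(1) by (intro herm_split)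
    then show ?thesis
      using ip_adj[OF Zfin v(1) u(1)] u(2) v(2) by (simp add: W_def add.commute)
  qed
  have orth_np: "herm (fn j) (fp i) = 0" if "i \<in> Sp" "j \<in> Sn" for i j
    using orth_pn[OF that] herm.cnj_commute[of "fp i" "fn j"] by simp
  have fin: "f i \<in> supp S" if "i \<in> S" for i
  proof -
    have "cvec.span (x ` Sn) \<subseteq> supp S" "cvec.span (x ` Sp) \<subseteq> supp S"
      by (rule cvec.span_minimal; use xS Sn(1) Sp(1) in auto)+
    moreover have "fn i \<in> cvec.span (x ` Sn)" if "i \<in> Sn" using fn(1) that by blast
    moreover have "fp i \<in> cvec.span (x ` Sp)" if "i \<in> Sp" using fp(1) that by blast
    ultimately show ?thesis using S_cases[OF that] f_n[of i] f_p[of i] by auto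
  qed
  have orth: "herm (f i) (f j) = (if i = j then sgn_idx i else 0)" if "i \<in> S" "j \<in> S" for i j
  proof -
    have disj: "Sn \<inter> Sp = {}" using neg_pos_disjoint[of q] by (auto simp: Sn_def Sp_def)
    have sp: "sgn_idx i = - 1" if "i \<in> Sp" for i
      using that Sp(2) pos_idx_pos by (force simp: sgn_idx_def)
    have sn: "sgn_idx i = 1" if "i \<in> Sn" for i
      using that Sn(2) by (auto simp: sgn_idx_def)
    have pp: "herm (fp i) (fp j) = (if i = j then - 1 else 0)" if "i \<in> Sp" "j \<in> Sp" for i j
      using fp(2)[OF that] by (metis minus_minus neg_0_equal_iff_equal)
    consider "i \<in> Sn" "j \<in> Sn" | "i \<in> Sn" "j \<in> Sp" | "i \<in> Sp" "j \<in> Sn" | "i \<in> Sp" "j \<in> Sp"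
      using S_cases \<open>i \<in> S\<close> \<open>j \<in> S\<close> by blast
    then show ?thesis
      using disj by cases (auto simp: f_n f_p fn(2) pp sn sp orth_pn orth_np)
  qed
  obtain g where g: "g \<in> SU q" "\<And>i. i \<in> S \<Longrightarrow> i \<noteq> - 1 \<Longrightarrow> g (bvec i) = f i"
    "\<And>i. i \<in> idx q - S \<Longrightarrow> g (bvec i) = bvec i"
    using SU_from_orthonormal[OF finS S fin orth] by metis
  have gI: "isom q g" using g(1) by (simp add: SU_iff)
  have gL: "g \<in> lin_maps (Vsp q) (Vsp q)" using gI by (simp add: isom_def)
  have gj: "g (bvec j) \<in> graph_of q Z" if j: "j \<in> pos_idx q" for j
  proof (cases "j \<in> S")
    case True
    then have "j \<in> Sp" using j by (simp add: Sp_def)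
    moreover have "j \<noteq> - 1" using pos_idx_pos[OF j] by simp
    ultimately show ?thesis using g(2)[OF True] f_p fp(1) span_p by auto
  next
    case False
    then have "Z (bvec j) = 0" using j by (auto simp: S_def cols_def)
    then have "bvec j + Z (bvec j) = g (bvec j)" using g(3)[of j] False j by simp
    moreover have "bvec j + Z (bvec j) \<in> graph_of q Z" using j by (simp add: graph_of_def)
    ultimately show ?thesis by simp
  qed
  have sub: "g ` V_minus q \<subseteq> graph_of q Z"
  proof -
    have "g ` V_minus q = cvec.span ((\<lambda>i. g (bvec i)) ` pos_idx q)"
      unfolding V_minus_eq by (rule lin_maps_image_supp[OF gL[unfolded Vsp_eq]]) simp
    also have "\<dots> \<subseteq> graph_of q Z"
      by (rule cvec.span_minimal[OF _ subspace_graph[OF Z]]) (use gj in blast)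
    finally show ?thesis .
  qed
  \<comment> \<open>Equality comes from definiteness. If \<open>y = g v + g u\<close> lies on the
    graph, so does \<open>g u\<close>; but \<open>herm\<close> is nonnegative on it, as
    \<open>u\<close> is in \<open>V_+\<close>, and hence \<open>g u = 0\<close>.\<close>
  moreover have "graph_of q Z \<subseteq> g ` V_minus q"
  proof
    fix y assume y: "y \<in> graph_of q Z"
    then have "y \<in> Vsp q" using graph_neg_def[OF assms] by (auto simp: neg_def_subspace_def)
    then obtain z where z: "z \<in> Vsp q" "y = g z" using isom_bij[OF gI] by (auto simp: bij_betw_def)
    define u where "u = restr neg_idx z"
    define v where "v = restr (pos_idx q) z"
    have u: "u \<in> V_plus" and v: "v \<in> V_minus q"
      by (simp_all add: u_def v_def V_plus_eq V_minus_eq restr_supp)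
    have "z = v + u" using Vsp_decomp[OF z(1)] by (simp add: u_def v_def)
    then have "y = g v + g u"
      using z(2) lin_maps_add[OF gL V_minus_Vsp[OF v] V_plus_Vsp[OF u]] by simp
    moreover have "g v \<in> graph_of q Z" using sub v by blast
    ultimately have gu: "g u \<in> graph_of q Z"
      using cvec.subspace_diff[OF subspace_graph[OF Z] y, of "g v"] by simp
    have "herm (g u) (g u) = ip u u"
      using gI V_plus_Vsp[OF u] by (simp add: isom_def herm_plus[OF u])
    then have "g u = 0"
      using gu graph_neg_def[OF assms] ip_self_nonneg[of u] by (force simp: neg_def_subspace_def)
    then show "y \<in> g ` V_minus q" using \<open>y = g v + g u\<close> v by simp
  qed
  ultimately show ?thesis using g(1) that by blast
qed

section \<open>Maximal negative definite subspaces\<close>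

text \<open>A vector of a larger negative definite space differs from the graph point with the same
  component in \<open>V_-\<close> by a vector of \<open>V_+\<close>. That difference lies in the
  larger space, and \<open>herm\<close> is nonnegative on it, so it is \<open>0\<close>.\<close>

lemma graph_maximal:
  assumes "Z \<in> matrix_domain q"
  shows "maximal_neg_def q (graph_of q Z)"
  unfolding maximal_neg_def_def
proof (intro conjI allI impI)
  note Z = matrix_domain_lin_maps[OF assms]
  show "neg_def_subspace q (graph_of q Z)" by (rule graph_neg_def[OF assms])
  fix W assume W: "neg_def_subspace q W \<and> graph_of q Z \<subseteq> W"
  have "w \<in> graph_of q Z" if w: "w \<in> W" for w
  proof -
    have wV: "w \<in> Vsp q" using W w by (auto simp: neg_def_subspace_def)
    define v where "v = restr (pos_idx q) w"
    have v: "v \<in> V_minus q" by (simp add: v_def V_minus_eq restr_supp)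
    have "restr neg_idx w \<in> V_plus" by (simp add: V_plus_eq restr_supp)
    then have u: "restr neg_idx w - Z v \<in> V_plus"
      using lin_maps_mem[OF Z v] by (simp add: cvec.subspace_diff)
    have eq: "restr neg_idx w - Z v = w - (v + Z v)"
      using Vsp_decomp[OF wV] by (simp add: v_def algebra_simps)
    have "v + Z v \<in> graph_of q Z" using v by (simp add: graph_of_def)
    then have "restr neg_idx w - Z v \<in> W"
      unfolding eq using W w by (auto simp: neg_def_subspace_def intro!: cvec.subspace_diff)
    then have "restr neg_idx w - Z v = 0"
      using W ip_self_nonneg[of "restr neg_idx w - Z v"] herm_plus[OF u]
      by (force simp: neg_def_subspace_def)
    then have "w = v + Z v" using eq by simp
    then show ?thesis using v by (simp add: graph_of_def)
  qed
  then show "W = graph_of q Z" using W by blast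
qed

text \<open>
  A nonzero vector of \<open>V_-\<close> orthogonal to \<open>F\<close> would enlarge \<open>F\<close>; as \<open>F\<close> is \<open>V_-\<close> up to
  finitely many vectors, orthogonal projections to the image of \<open>F\<close> in \<open>V_-\<close> exist, and so
  that image is all of \<open>V_-\<close>.
\<close>

lemma maximal_projects_onto:
  assumes max: "maximal_neg_def q F"
    and F: "F = cvec.span (b ` pos_idx q)"
    and fin: "finite {j \<in> pos_idx q. b j \<noteq> bvec j}"
  shows "restr (pos_idx q) ` F = V_minus q"
proof -
  define M where "M = {j \<in> pos_idx q. b j \<noteq> bvec j}"
  let ?\<pi> = "restr (pos_idx q)"
  have sub: "cvec.subspace F" and neg: "\<And>x. x \<in> F \<Longrightarrow> x \<noteq> 0 \<Longrightarrow> Re (herm x x) < 0"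
    and FV: "F \<subseteq> Vsp q"
    using max by (auto simp: maximal_neg_def_def neg_def_subspace_def)
  have bF: "b j \<in> F" if "j \<in> pos_idx q" for j
    unfolding F using that by (auto intro: cvec.span_base)
  have "restrict ?\<pi> F \<in> lin_maps F UNIV"
    using sub by (auto simp: lin_maps_def restr_add restr_scale cvec.subspace_add cvec.subspace_scale)
  from subspace_lin_maps_image[OF this sub] have subP: "cvec.subspace (?\<pi> ` F)" by simp
  \<comment> \<open>Basis vectors outside \<open>M\<close> lie in \<open>F\<close> themselves, so
    only the finitely many indices in \<open>M\<close> remain to be settled.\<close>
  have off_M: "bvec k \<in> ?\<pi> ` F" if "k \<in> pos_idx q" "k \<notin> M" for k
  proof -
    have "bvec k \<in> F" using that bF[of k] by (simp add: M_def)
    moreover have "?\<pi> (bvec k) = bvec k" using that by (simp add: restr_id)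
    ultimately show ?thesis by (metis image_eqI)
  qed
  have off_M_supp: "supp (pos_idx q - M) \<subseteq> ?\<pi> ` F"
    unfolding span_bvec[symmetric] by (rule cvec.span_minimal[OF _ subP]) (use off_M in auto)
  \<comment> \<open>\<open>B\<close> is the trace on the block \<open>M\<close> of the exceptional
    generators. It is finite, so projections onto its span exist, and it lies in the projected
    space, since the discarded positive coordinates belong to fixed basis vectors.\<close>
  define B where "B = (\<lambda>j. restr M (b j)) ` M"
  have MB: "M \<subseteq> pos_idx q" by (auto simp: M_def)
  have "restr M (b j) \<in> ?\<pi> ` F" if "j \<in> M" for j
  proof -
    have "restr M (b j) = ?\<pi> (b j) - restr (pos_idx q - M) (b j)"
      using MB by (intro poly_mapping_eqI) (auto simp: lk_restr lk_minus)
    moreover have "?\<pi> (b j) \<in> ?\<pi> ` F" using that MB bF by blast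
    moreover have "restr (pos_idx q - M) (b j) \<in> ?\<pi> ` F" using off_M_supp restr_supp by blast
    ultimately show ?thesis using cvec.subspace_diff[OF subP] by simp
  qed
  then have BP: "cvec.span B \<subseteq> ?\<pi> ` F"
    by (intro cvec.span_minimal[OF _ subP]) (auto simp: B_def)
  have "bvec k \<in> ?\<pi> ` F" if k: "k \<in> M" for k
  proof -
    have "\<exists>p\<in>cvec.span B. \<forall>c\<in>cvec.span B. ip (bvec k - p) c = 0"
    proof (rule ip.projection_exists)
      show "finite B" using fin by (simp add: B_def M_def)
      show "ip y y \<noteq> 0" if "y \<noteq> 0" for y using ip_self_pos[OF that] by auto
    qed
    then obtain p where p: "p \<in> cvec.span B" "\<And>c. c \<in> cvec.span B \<Longrightarrow> ip (bvec k - p) c = 0" by blast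
    \<comment> \<open>The defect of \<open>bvec k\<close>. Its support lies in \<open>M\<close>, so
      it is orthogonal to the fixed basis vectors, and the choice of \<open>p\<close> makes it
      orthogonal to the other generators of \<open>F\<close>.\<close>
    define u where "u = bvec k - p"
    have "cvec.span B \<subseteq> supp M"
      by (rule cvec.span_minimal) (auto simp: B_def restr_supp)
    then have uM: "u \<in> supp M"
      unfolding u_def using p(1) k by (intro cvec.subspace_diff[OF subspace_supp]) auto
    have uV: "u \<in> V_minus q" unfolding V_minus_eq by (rule supp_mono[OF MB uM])
    have ub: "herm u (b j) = 0" if j: "j \<in> pos_idx q" for j
    proof (cases "j \<in> M")
      case True
      have "b j = restr M (b j) + restr (- M) (b j)"
        by (intro poly_mapping_eqI) (simp add: lookup_add lk_restr)
      then have "ip u (b j) = ip u (restr M (b j)) + ip u (restr (- M) (b j))"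
        by (metis ip.add_right)
      moreover have "ip u (restr (- M) (b j)) = 0"
        by (rule ip_disjoint[OF uM restr_supp]) simp
      moreover have "ip u (restr M (b j)) = 0"
        unfolding u_def by (rule p(2)) (use True in \<open>auto simp: B_def intro: cvec.span_base\<close>)
      ultimately show ?thesis by (simp add: herm_minus[OF uV])
    next
      case False
      then have "b j = bvec j" using j by (simp add: M_def)
      then show ?thesis using uM False by (simp add: herm_bvec_right supp_iff)
    qed
    have uF: "herm u y = 0" if "y \<in> F" for y
      using herm.orthogonal_span[of y "b ` pos_idx q" u] that ub F by auto
    have Fu: "herm y u = 0" if "y \<in> F" for y
      using uF[OF that] herm.cnj_commute[of u y] by simp
    have "u = 0"
    proof (rule ccontr)
      assume u0: "u \<noteq> 0"
      have uneg: "Re (herm u u) < 0" using ip_self_pos[OF u0] by (simp add: herm_minus[OF uV])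
      have "neg_def_subspace q (cvec.span (insert u F))"
        unfolding neg_def_subspace_def
      proof (intro conjI ballI impI)
        show "cvec.span (insert u F) \<subseteq> Vsp q"
          using FV V_minus_Vsp[OF uV] by (intro cvec.span_minimal) auto
        fix x assume x: "x \<in> cvec.span (insert u F)" "x \<noteq> 0"
        then obtain c where c: "x - cscale c u \<in> cvec.span F"
          using cvec.span_breakdown_eq by blast
        define y where "y = x - cscale c u"
        have y: "y \<in> F" using c sub by (simp add: y_def cvec.span_eq_iff[THEN iffD2])
        have xy: "x = y + cscale c u" by (simp add: y_def)
        have "herm x x = herm y y + c * cnj c * herm u u"
          unfolding xy by (simp add: herm.add_left herm.add_right herm.scale_left herm.scale_right
              uF[OF y] Fu[OF y])
        then have hx: "Re (herm x x) = Re (herm y y) + (cmod c)\<^sup>2 * Re (herm u u)"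
          by (simp add: complex_mult_cnj cmod_def)
        show "Re (herm x x) < 0"
        proof (cases "c = 0")
          case True
          then show ?thesis using hx neg[OF y] x(2) xy by simp
        next
          case False
          then have "(cmod c)\<^sup>2 * Re (herm u u) < 0" using uneg by (simp add: mult_pos_neg)
          moreover have "Re (herm y y) \<le> 0" using neg[OF y] by (cases "y = 0") auto
          ultimately show ?thesis using hx by simp
        qed
      qed (rule cvec.subspace_span)
      then have "cvec.span (insert u F) = F"
        using max cvec.span_superset[of "insert u F"] by (auto simp: maximal_neg_def_def)
      then have "u \<in> F" using cvec.span_base[of u "insert u F"] by simp
      then show False using uF uneg by force
    qed
    then have "bvec k = p" by (simp add: u_def)
    then show ?thesis using p(1) BP by blast
  qed
  then have "supp (pos_idx q) \<subseteq> ?\<pi> ` F"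
    unfolding span_bvec[symmetric] using off_M by (intro cvec.span_minimal[OF _ subP]) auto
  then show ?thesis by (auto simp: V_minus_eq restr_supp)
qed

lemma maximal_is_graph:
  assumes max: "maximal_neg_def q F"
    and F: "F = cvec.span (b ` pos_idx q)"
    and fin: "finite {j \<in> pos_idx q. b j \<noteq> bvec j}"
  shows "\<exists>Z\<in>matrix_domain q. F = graph_of q Z"
proof -
  let ?\<pi> = "restr (pos_idx q)"
  have sub: "cvec.subspace F" and neg: "\<And>x. x \<in> F \<Longrightarrow> x \<noteq> 0 \<Longrightarrow> Re (herm x x) < 0"
    and FV: "F \<subseteq> Vsp q"
    using max by (auto simp: maximal_neg_def_def neg_def_subspace_def)
  note onto = maximal_projects_onto[OF assms]
  have decomp: "y = ?\<pi> y + restr neg_idx y" if "y \<in> F" for y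
    using Vsp_decomp FV that by blast
  \<comment> \<open>Vectors with the same component in \<open>V_-\<close> differ by a vector of
    \<open>V_+\<close>, where \<open>herm\<close> is nonnegative.\<close>
  have inj: "x = y" if "x \<in> F" "y \<in> F" "?\<pi> x = ?\<pi> y" for x y
  proof -
    have d: "x - y \<in> F" using cvec.subspace_diff[OF sub] that by blast
    have "?\<pi> (x - y) = 0" using that(3) by (simp add: restr_diff)
    then have "restr neg_idx (x - y) = x - y" using decomp[OF d] by simp
    then have "x - y \<in> V_plus" by (metis V_plus_eq restr_supp)
    then have "0 \<le> Re (herm (x - y) (x - y))" by (simp add: herm_plus ip_self_nonneg)
    then show ?thesis using neg[OF d] by force
  qed
  define s where "s = (\<lambda>v. THE y. y \<in> F \<and> ?\<pi> y = v)"
  have s_eq: "s (?\<pi> y) = y" if "y \<in> F" for y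
    unfolding s_def using that inj by (intro the_equality) auto
  have s: "s v \<in> F" "?\<pi> (s v) = v" if "v \<in> V_minus q" for v
    using that s_eq unfolding onto[symmetric] by auto
  define Z where "Z = (\<lambda>v\<in>V_minus q. restr neg_idx (s v))"
  have sZ: "s v = v + Z v" if "v \<in> V_minus q" for v
    using decomp[OF s(1)[OF that]] s(2)[OF that] that by (simp add: Z_def)
  have s_add: "s (v + w) = s v + s w" if "v \<in> V_minus q" "w \<in> V_minus q" for v w
    using s_eq[of "s v + s w"] s that cvec.subspace_add[OF sub] by (simp add: restr_add)
  have s_scale: "s (cscale c v) = cscale c (s v)" if "v \<in> V_minus q" for c v
    using s_eq[of "cscale c (s v)"] s that cvec.subspace_scale[OF sub] by (simp add: restr_scale)
  have Z: "Z \<in> lin_maps (V_minus q) V_plus"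
    unfolding lin_maps_def
    by (auto simp: Z_def V_plus_eq restr_supp s_add s_scale restr_add restr_scale
        cvec.subspace_add cvec.subspace_scale)
  have "F = graph_of q Z"
  proof
    show "graph_of q Z \<subseteq> F" using s(1) sZ by (auto simp: graph_of_def)
    show "F \<subseteq> graph_of q Z"
    proof
      fix y assume "y \<in> F"
      moreover from this have v: "?\<pi> y \<in> V_minus q" using onto by blast
      ultimately have "y = ?\<pi> y + Z (?\<pi> y)" using sZ[OF v] s_eq by simp
      then show "y \<in> graph_of q Z" using v unfolding graph_of_def by blast
    qed
  qed
  moreover have "Z \<in> matrix_domain q"
    unfolding matrix_domain_iff
  proof (intro conjI ballI impI)
    \<comment> \<open>If the generator \<open>b j\<close> is \<open>bvec j\<close>, then
      \<open>bvec j\<close> lies on the graph and column \<open>j\<close> of \<open>Z\<close> is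
      zero. So only the finitely many changed generators can give nonzero columns.\<close>
    have "cols q Z \<subseteq> {j \<in> pos_idx q. b j \<noteq> bvec j}"
    proof
      fix j assume j: "j \<in> cols q Z"
      have "Z (bvec j) = 0" if "b j = bvec j"
      proof -
        have "b j \<in> F" unfolding F by (rule cvec.span_base) (use j in \<open>simp add: cols_def\<close>)
        then have "bvec j \<in> F" by (simp only: that)
        moreover have "?\<pi> (bvec j) = bvec j" using j by (simp add: cols_def restr_id)
        ultimately have "s (bvec j) = bvec j" using s_eq by metis
        then show ?thesis using sZ[of "bvec j"] j by (simp add: cols_def)
      qed
      then show "j \<in> {j \<in> pos_idx q. b j \<noteq> bvec j}" using j by (auto simp: cols_def)
    qed
    then show "Z \<in> finitary_maps q"
      using finitary_iff_cols[OF Z] fin finite_subset by blast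
    fix v assume v: "v \<in> V_minus q" "v \<noteq> 0"
    have Zv: "Z v \<in> V_plus" by (rule lin_maps_mem[OF Z v(1)])
    have "?\<pi> (s v) \<noteq> 0" using s(2) v by simp
    then have "s v \<noteq> 0" by (auto simp: restr_def)
    then have "Re (herm (v + Z v) (v + Z v)) < 0" using neg[OF s(1)[OF v(1)]] sZ[OF v(1)] by simp
    then show "Re (ip (Z v) (Z v)) < Re (ip v v)" using herm_split[OF Zv Zv v(1) v(1)] by simp
  qed
  ultimately show ?thesis by blast
qed

text \<open>A larger negative definite space pulls back along \<open>g\<close> to a negative
  definite space containing \<open>F\<close>; surjectivity of \<open>g\<close> carries the resulting
  equality back.\<close>

lemma isom_maximal:
  assumes g: "isom q g" and max: "maximal_neg_def q F"
  shows "maximal_neg_def q (g ` F)"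
  unfolding maximal_neg_def_def
proof (intro conjI allI impI)
  have gL: "g \<in> lin_maps (Vsp q) (Vsp q)"
    and pres: "\<And>x. x \<in> Vsp q \<Longrightarrow> herm (g x) (g x) = herm x x"
    using g by (auto simp: isom_def)
  note bij = isom_bij[OF g]
  have sub: "cvec.subspace F" and neg: "\<And>x. x \<in> F \<Longrightarrow> x \<noteq> 0 \<Longrightarrow> Re (herm x x) < 0"
    and FV: "F \<subseteq> Vsp q"
    using max by (auto simp: maximal_neg_def_def neg_def_subspace_def)
  have "restrict g F \<in> lin_maps F (Vsp q)"
    using gL FV sub unfolding lin_maps_def
    by (auto simp: cvec.subspace_add cvec.subspace_scale subset_iff PiE_iff)
  from subspace_lin_maps_image[OF this sub] have subg: "cvec.subspace (g ` F)" by simp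
  show "neg_def_subspace q (g ` F)"
    unfolding neg_def_subspace_def
  proof (intro conjI ballI impI)
    show "g ` F \<subseteq> Vsp q" using FV lin_maps_mem[OF gL] by auto
    fix x assume "x \<in> g ` F" "x \<noteq> 0"
    then obtain y where y: "y \<in> F" "x = g y" by auto
    then have "y \<noteq> 0" using \<open>x \<noteq> 0\<close> lin_maps_zero[OF gL] by auto
    then show "Re (herm x x) < 0" using y neg FV by (auto simp: pres)
  qed (rule subg)
  fix W assume W: "neg_def_subspace q W \<and> g ` F \<subseteq> W"
  define U where "U = {x \<in> Vsp q. g x \<in> W}"
  have Wsub: "cvec.subspace W" "W \<subseteq> Vsp q" and Wneg: "\<And>x. x \<in> W \<Longrightarrow> x \<noteq> 0 \<Longrightarrow> Re (herm x x) < 0"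
    using W by (auto simp: neg_def_subspace_def)
  have "neg_def_subspace q U"
    unfolding neg_def_subspace_def
  proof (intro conjI ballI impI)
    show "cvec.subspace U"
      using Wsub(1) lin_maps_zero[OF gL subspaces(3)]
        lin_maps_add[OF gL] lin_maps_scale[OF gL] cvec.subspace_0[OF subspaces(3)]
        cvec.subspace_add[OF subspaces(3)] cvec.subspace_scale[OF subspaces(3)]
      by (simp add: cvec.subspace_def U_def)
    show "U \<subseteq> Vsp q" by (auto simp: U_def)
    fix x assume x: "x \<in> U" "x \<noteq> 0"
    then have "g x \<noteq> 0"
      using bij lin_maps_zero[OF gL] cvec.subspace_0[OF subspaces(3)]
      by (auto simp: bij_betw_def inj_on_def U_def)
    then show "Re (herm x x) < 0" using Wneg[of "g x"] x pres[of x] by (simp add: U_def)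
  qed
  moreover have "F \<subseteq> U" using W FV by (auto simp: U_def)
  ultimately have "U = F" using max by (auto simp: maximal_neg_def_def)
  moreover have "W \<subseteq> g ` U"
    using Wsub(2) bij by (force simp: U_def bij_betw_def)
  ultimately show "W = g ` F" using W by blast
qed

section \<open>The domain as a set of graphs and as an orbit\<close>

lemma zero_matrix_domain: "(\<lambda>v\<in>V_minus q. 0) \<in> matrix_domain q"
  unfolding matrix_domain_iff
proof (intro conjI ballI impI)
  have Z: "(\<lambda>v\<in>V_minus q. 0) \<in> lin_maps (V_minus q) V_plus"
    by (auto simp: lin_maps_def cvec.subspace_add cvec.subspace_scale cvec.subspace_0)
  have "cols q (\<lambda>v\<in>V_minus q. 0) = {}" by (auto simp: cols_def)
  then show "(\<lambda>v\<in>V_minus q. 0) \<in> finitary_maps q" using finitary_iff_cols[OF Z] by simp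
qed (simp add: ip_self_pos)

lemma V_minus_maximal: "maximal_neg_def q (V_minus q)"
  using graph_maximal[OF zero_matrix_domain, of q] by (simp add: graph_of_def)

lemma act_base_flag:
  assumes "isom q g"
  shows "act g (base_flag q) = ({0}, g ` V_minus q, Vsp q)"
proof -
  have "g 0 = 0" using assms lin_maps_zero[OF _ subspaces(3)] by (auto simp: isom_def)
  then show ?thesis using isom_bij[OF assms] by (simp add: act_def base_flag_def bij_betw_def)
qed

text \<open>From left to right, the flag manifold enters through the vectors
  \<open>g (bvec j)\<close>, which span the subspace and differ from \<open>bvec j\<close> for
  finitely many \<open>j\<close>. From right to left, transitivity exhibits the graph as a translate
  of \<open>V_-\<close>.\<close>

lemma D0_iff: "F \<in> D0 q \<longleftrightarrow> (\<exists>Z\<in>matrix_domain q. F = ({0}, graph_of q Z, Vsp q))"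
proof
  assume "F \<in> D0 q"
  then obtain F1 where F: "F = ({0}, F1, Vsp q)" "({0}, F1, Vsp q) \<in> flag_manifold q"
    and max: "maximal_neg_def q F1" by (auto simp: D0_def)
  then obtain g where g: "g \<in> SL q" "F1 = g ` V_minus q"
    by (auto simp: flag_manifold_def act_def base_flag_def)
  have gL: "g \<in> lin_maps (supp (idx q)) (Vsp q)" using g(1) by (simp add: SL_def Vsp_eq)
  have "F1 = cvec.span ((\<lambda>i. g (bvec i)) ` pos_idx q)"
    unfolding g(2) V_minus_eq by (rule lin_maps_image_supp[OF gL]) simp
  moreover have "finite {j \<in> pos_idx q. g (bvec j) \<noteq> bvec j}"
    by (rule finite_subset[of _ "moved q g"]) (use g(1) in \<open>auto simp: SL_def moved_def\<close>)
  ultimately show "\<exists>Z\<in>matrix_domain q. F = ({0}, graph_of q Z, Vsp q)"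
    using maximal_is_graph[OF max] F(1) by blast
next
  assume "\<exists>Z\<in>matrix_domain q. F = ({0}, graph_of q Z, Vsp q)"
  then obtain Z where Z: "Z \<in> matrix_domain q" "F = ({0}, graph_of q Z, Vsp q)" by blast
  obtain g where g: "g \<in> SU q" "g ` V_minus q = graph_of q Z" by (rule SU_transitive[OF Z(1)])
  have "F = act g (base_flag q)" using act_base_flag[of q g] g Z(2) by (simp add: SU_iff)
  moreover have "g \<in> SL q" using g(1) by (simp add: SU_def)
  ultimately have "F \<in> flag_manifold q" by (auto simp: flag_manifold_def)
  then show "F \<in> D0 q" using Z graph_maximal by (simp add: D0_def)
qed

lemma D0_eq_orbit: "D0 q = (\<lambda>g. act g (base_flag q)) ` SU q"
proof
  show "D0 q \<subseteq> (\<lambda>g. act g (base_flag q)) ` SU q"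
  proof
    fix F assume "F \<in> D0 q"
    then obtain Z where Z: "Z \<in> matrix_domain q" "F = ({0}, graph_of q Z, Vsp q)"
      by (auto simp: D0_iff)
    obtain g where g: "g \<in> SU q" "g ` V_minus q = graph_of q Z" by (rule SU_transitive[OF Z(1)])
    then have "F = act g (base_flag q)" using act_base_flag[of q g] Z(2) by (simp add: SU_iff)
    then show "F \<in> (\<lambda>g. act g (base_flag q)) ` SU q" using g(1) by blast
  qed
  show "(\<lambda>g. act g (base_flag q)) ` SU q \<subseteq> D0 q"
  proof (rule image_subsetI)
    fix g assume g: "g \<in> SU q"
    then have I: "isom q g" by (simp add: SU_iff)
    have "act g (base_flag q) \<in> flag_manifold q"
      using g by (auto simp: flag_manifold_def SU_def)
    then show "act g (base_flag q) \<in> D0 q"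
      using isom_maximal[OF I V_minus_maximal] by (simp add: D0_def act_base_flag[OF I])
  qed
qed

text \<open>The argument goes through maximality: isometries preserve it, and the composite of two
  group elements still moves finitely many basis vectors, so the image is again the graph of a map
  in \<open>matrix_domain q\<close>.\<close>

lemma act_D0:
  assumes g: "g \<in> SU q" and F: "F \<in> D0 q"
  shows "act g F \<in> D0 q"
proof -
  have I: "isom q g" using g by (simp add: SU_iff)
  have gL: "g \<in> lin_maps (Vsp q) (Vsp q)" using I by (simp add: isom_def)
  obtain g0 where g0: "g0 \<in> SU q" "F = act g0 (base_flag q)"
    using F by (auto simp: D0_eq_orbit)
  have I0: "isom q g0" using g0(1) by (simp add: SU_iff)
  have g0L: "g0 \<in> lin_maps (Vsp q) (Vsp q)" using I0 by (simp add: isom_def)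
  have F_eq: "F = ({0}, g0 ` V_minus q, Vsp q)" using g0(2) act_base_flag[OF I0] by simp
  have gF: "act g F = ({0}, g ` g0 ` V_minus q, Vsp q)"
    using isom_bij[OF I] lin_maps_zero[OF gL] by (simp add: F_eq act_def bij_betw_def)
  have max: "maximal_neg_def q (g ` g0 ` V_minus q)"
    by (intro isom_maximal[OF I] isom_maximal[OF I0] V_minus_maximal)
  \<comment> \<open>Restriction makes the composite extensional, as \<open>lin_maps\<close>
    demands.\<close>
  define h where "h = restrict (g \<circ> g0) (Vsp q)"
  have h: "h \<in> lin_maps (supp (idx q)) (Vsp q)"
    using lin_maps_mem[OF g0L] lin_maps_mem[OF gL]
    by (auto simp: lin_maps_def h_def Vsp_eq[symmetric] cvec.subspace_add cvec.subspace_scale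
        lin_maps_add[OF g0L] lin_maps_add[OF gL] lin_maps_scale[OF g0L] lin_maps_scale[OF gL])
  have "g ` g0 ` V_minus q = h ` V_minus q"
    using V_minus_Vsp by (auto simp: h_def image_image intro!: image_cong)
  also have "\<dots> = cvec.span ((\<lambda>i. h (bvec i)) ` pos_idx q)"
    unfolding V_minus_eq by (rule lin_maps_image_supp[OF h]) simp
  finally have span: "g ` g0 ` V_minus q = cvec.span ((\<lambda>i. h (bvec i)) ` pos_idx q)" .
  have "finite {j \<in> pos_idx q. h (bvec j) \<noteq> bvec j}"
  proof (rule finite_subset)
    show "{j \<in> pos_idx q. h (bvec j) \<noteq> bvec j} \<subseteq> moved q g \<union> moved q g0"
      by (auto simp: h_def moved_def)
    show "finite (moved q g \<union> moved q g0)" using I I0 by (simp add: isom_def)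
  qed
  then show ?thesis
    using maximal_is_graph[OF max span] gF D0_iff by metis
qed

section \<open>Graph coordinates and the fractional linear action\<close>

lemma restr_graph:
  assumes "Z \<in> lin_maps (V_minus q) V_plus" "v \<in> V_minus q"
  shows "restr (pos_idx q) (v + Z v) = v" "restr neg_idx (v + Z v) = Z v"
  using lin_maps_mem[OF assms] assms(2) neg_pos_disjoint[of q]
  by (simp_all add: restr_add V_plus_eq V_minus_eq restr_id restr_0[of _ neg_idx] restr_0[of _ "pos_idx q"]
      Int_commute)

text \<open>Evaluation at \<open>v + Z v\<close> forces \<open>Z' v = Z v\<close>, and outside
  \<open>V_-\<close> both maps are \<open>undefined\<close>.\<close>

lemma graph_map_of_graph:
  assumes "Z \<in> lin_maps (V_minus q) V_plus"
  shows "graph_map_of q (A, graph_of q Z, C) Z' \<longleftrightarrow> Z' = Z"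
proof
  assume Z': "graph_map_of q (A, graph_of q Z, C) Z'"
  then have L: "Z' \<in> lin_maps (V_minus q) V_plus" by (simp add: graph_map_of_def)
  have "Z' v = Z v" if v: "v \<in> V_minus q" for v
  proof -
    have "v + Z v \<in> graph_of q Z" using v by (simp add: graph_of_def)
    then have "Z' (restr (pos_idx q) (v + Z v)) = restr neg_idx (v + Z v)"
      using Z' by (simp add: graph_map_of_def \<pi>_minus_eq \<pi>_plus_eq)
    then show ?thesis by (simp add: restr_graph[OF assms v])
  qed
  then show "Z' = Z"
    using lin_maps_ext[OF L] lin_maps_ext[OF assms] by (metis ext)
next
  assume "Z' = Z"
  then show "graph_map_of q (A, graph_of q Z, C) Z'"
    using assms restr_graph[OF assms]
    by (auto simp: graph_map_of_def \<pi>_minus_eq \<pi>_plus_eq graph_of_def)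
qed

lemma Z_of_graph: "Z \<in> lin_maps (V_minus q) V_plus \<Longrightarrow> Z_of q (A, graph_of q Z, C) = Z"
  by (simp add: Z_of_def graph_map_of_graph)

lemma Z_of_bij: "bij_betw (Z_of q) (D0 q) (matrix_domain q)"
  by (rule bij_betw_byWitness[where f' = "\<lambda>Z. ({0}, graph_of q Z, Vsp q)"])
    (auto simp: D0_iff Z_of_graph matrix_domain_lin_maps)

text \<open>The denominator is a composite of three bijections: from \<open>V_-\<close> up to the
  graph of \<open>Z\<close>, by \<open>g\<close> to the image graph, and down to \<open>V_-\<close>.
  So \<open>CZ + D\<close> is invertible. The numerator is the other component of the same point of
  the image graph, and this is the formula.\<close>

lemma frac_lin_action:
  assumes g: "g \<in> SU q" and F: "F \<in> D0 q"
  shows "bij_betw (denom q g (Z_of q F)) (V_minus q) (V_minus q)"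
    and "Z_of q (act g F) = frac_lin q g (Z_of q F)"
proof -
  have I: "isom q g" using g by (simp add: SU_iff)
  have gL: "g \<in> lin_maps (Vsp q) (Vsp q)" using I by (simp add: isom_def)
  obtain Z where Z: "Z \<in> matrix_domain q" "F = ({0}, graph_of q Z, Vsp q)"
    using F by (auto simp: D0_iff)
  note ZL = matrix_domain_lin_maps[OF Z(1)]
  have ZF: "Z_of q F = Z" by (simp add: Z(2) Z_of_graph[OF ZL])
  obtain Z' where Z': "Z' \<in> matrix_domain q" "act g F = ({0}, graph_of q Z', Vsp q)"
    using act_D0[OF g F] by (auto simp: D0_iff)
  note ZL' = matrix_domain_lin_maps[OF Z'(1)]
  have ZF': "Z_of q (act g F) = Z'" by (simp add: Z'(2) Z_of_graph[OF ZL'])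
  have gG: "g ` graph_of q Z = graph_of q Z'" using Z(2) Z'(2) by (simp add: act_def)
  have GV: "graph_of q Z \<subseteq> Vsp q" using graph_neg_def[OF Z(1)] by (simp add: neg_def_subspace_def)
  have split: "g (v + Z v) = g (Z v) + g v" if "v \<in> V_minus q" for v
    using lin_maps_add[OF gL V_minus_Vsp[OF that] V_plus_Vsp[OF lin_maps_mem[OF ZL that]]]
    by (simp add: add.commute)
  have den: "denom q g Z v = restr (pos_idx q) (g (v + Z v))" if "v \<in> V_minus q" for v
    using that lin_maps_mem[OF ZL that]
    by (simp add: denom_def block_C_def block_D_def \<pi>_minus_eq split restr_add)
  have num: "numer q g Z v = restr neg_idx (g (v + Z v))" if "v \<in> V_minus q" for v
    using that lin_maps_mem[OF ZL that]
    by (simp add: numer_def block_A_def block_B_def \<pi>_plus_eq split restr_add)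
  have b1: "bij_betw (\<lambda>v. v + Z v) (V_minus q) (graph_of q Z)"
    by (rule bij_betw_byWitness[where f' = "restr (pos_idx q)"])
      (use restr_graph[OF ZL] in \<open>auto simp: graph_of_def\<close>)
  have b2: "bij_betw g (graph_of q Z) (graph_of q Z')"
    using isom_bij[OF I] GV gG inj_on_subset by (auto simp: bij_betw_def)
  have b3: "bij_betw (restr (pos_idx q)) (graph_of q Z') (V_minus q)"
    by (rule bij_betw_byWitness[where f' = "\<lambda>v. v + Z' v"])
      (use restr_graph[OF ZL'] in \<open>auto simp: graph_of_def\<close>)
  have "bij_betw (restr (pos_idx q) \<circ> (g \<circ> (\<lambda>v. v + Z v))) (V_minus q) (V_minus q)"
    using bij_betw_trans[OF bij_betw_trans[OF b1 b2] b3] .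
  then have bij: "bij_betw (denom q g Z) (V_minus q) (V_minus q)"
    by (rule bij_betw_cong[THEN iffD1, rotated]) (simp add: den)
  then show "bij_betw (denom q g (Z_of q F)) (V_minus q) (V_minus q)" by (simp add: ZF)
  have Z'den: "Z' (denom q g Z v) = numer q g Z v" if v: "v \<in> V_minus q" for v
  proof -
    have "g (v + Z v) \<in> graph_of q Z'" using v gG by (auto simp: graph_of_def)
    then obtain w where "w \<in> V_minus q" "g (v + Z v) = w + Z' w" by (auto simp: graph_of_def)
    then show ?thesis using restr_graph[OF ZL'] v by (simp add: den num)
  qed
  have "Z' w = frac_lin q g Z w" for w
  proof (cases "w \<in> V_minus q")
    case True
    define v where "v = inv_into (V_minus q) (denom q g Z) w"
    have "v \<in> V_minus q" "denom q g Z v = w"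
      using bij True by (auto simp: v_def bij_betw_def inv_into_into f_inv_into_f)
    then have "Z' w = numer q g Z v" using Z'den by metis
    then show ?thesis using True by (simp add: frac_lin_def v_def)
  next
    case False
    then show ?thesis using lin_maps_ext[OF ZL'] by (simp add: frac_lin_def)
  qed
  then show "Z_of q (act g F) = frac_lin q g (Z_of q F)" by (auto simp: ZF ZF')
qed

section \<open>The topology of the matrix domain\<close>

definition nrm :: "cvec \<Rightarrow> real" where
  "nrm x = sqrt (Re (ip x x))"

text \<open>Any finite index set containing the support will do, so two vectors can be compared in a
  common one; \<open>L2_set\<close> then supplies the triangle inequality.\<close>

lemma nrm_L2:
  assumes "finite A" "x \<in> supp A"
  shows "nrm x = L2_set (\<lambda>i. cmod (lk x i)) A"
proof -
  have "Re (ip x x) = (\<Sum>i\<in>A. (cmod (lk x i))\<^sup>2)"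
    unfolding ip_sum[OF assms] by (simp add: complex_mult_cnj cmod_def)
  then show ?thesis by (simp add: nrm_def L2_set_def)
qed

lemma nrm_power2: "(nrm x)\<^sup>2 = Re (ip x x)"
  by (simp add: nrm_def ip_self_nonneg)

lemma nrm_nonneg [simp]: "0 \<le> nrm x"
  by (simp add: nrm_def ip_self_nonneg)

lemma nrm_pos: "x \<noteq> 0 \<Longrightarrow> 0 < nrm x"
  by (simp add: nrm_def ip_self_pos)

lemma nrm_zero [simp]: "nrm 0 = 0"
  by (simp add: nrm_def)

lemma nrm_triangle: "nrm (x + y) \<le> nrm x + nrm y"
proof -
  let ?A = "Poly_Mapping.keys x \<union> Poly_Mapping.keys y"
  have s: "x + y \<in> supp ?A" "x \<in> supp ?A" "y \<in> supp ?A"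
    by (auto simp: supp_iff lookup_add in_keys_iff)
  have "nrm (x + y) = L2_set (\<lambda>i. cmod (lk x i + lk y i)) ?A"
    using s by (simp add: nrm_L2[of ?A] lookup_add)
  also have "\<dots> \<le> L2_set (\<lambda>i. cmod (lk x i) + cmod (lk y i)) ?A"
    by (rule L2_set_mono) (auto simp: norm_triangle_ineq)
  also have "\<dots> \<le> L2_set (\<lambda>i. cmod (lk x i)) ?A + L2_set (\<lambda>i. cmod (lk y i)) ?A"
    by (rule L2_set_triangle_ineq)
  finally show ?thesis using s by (simp add: nrm_L2[of ?A])
qed

lemma nrm_scale: "nrm (cscale c x) = cmod c * nrm x"
proof -
  have "ip (cscale c x) (cscale c x) = of_real ((cmod c)\<^sup>2) * ip x x"
    unfolding complex_norm_square by (simp add: ip.scale_left ip.scale_right mult.assoc)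
  then have "Re (ip (cscale c x) (cscale c x)) = (cmod c)\<^sup>2 * Re (ip x x)" by simp
  then show ?thesis by (simp add: nrm_def real_sqrt_mult)
qed

lemma nrm_sum: "nrm (sum f A) \<le> (\<Sum>a\<in>A. nrm (f a))"
proof (induction A rule: infinite_finite_induct)
  case (insert a A)
  then show ?case using nrm_triangle[of "f a" "sum f A"] by simp
qed simp_all

lemma cmod_lk_le_nrm: "cmod (lk x i) \<le> nrm x"
  using member_le_L2_set[of "insert i (Poly_Mapping.keys x)" i "\<lambda>i. cmod (lk x i)"]
    nrm_L2[of "insert i (Poly_Mapping.keys x)" x] by (simp add: supp_def subset_insertI)

lemma nrm_le_sum:
  assumes "finite A" "x \<in> supp A"
  shows "nrm x \<le> (\<Sum>i\<in>A. cmod (lk x i))"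
  unfolding nrm_L2[OF assms] by (rule L2_set_le_sum) simp

text \<open>A crude operator bound by the sum of the norms of the nonzero columns. It serves for
  \<open>g\<close> minus the identity and for the difference of two maps in the same block.\<close>

lemma nrm_lin_le:
  assumes "finite K" "\<And>j. j \<in> S - K \<Longrightarrow> b j = 0" "x \<in> supp S"
  shows "nrm (lin b x) \<le> nrm x * (\<Sum>j\<in>K. nrm (b j))"
proof -
  have "lin b x = (\<Sum>j\<in>Poly_Mapping.keys x \<inter> K. cscale (lk x j) (b j))"
    unfolding lin_def
    by (rule sum.mono_neutral_right) (use assms(2,3) in \<open>auto simp: supp_def\<close>)
  then have "nrm (lin b x) \<le> (\<Sum>j\<in>Poly_Mapping.keys x \<inter> K. nrm (cscale (lk x j) (b j)))"
    by (simp add: nrm_sum)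
  also have "\<dots> \<le> (\<Sum>j\<in>Poly_Mapping.keys x \<inter> K. nrm x * nrm (b j))"
    by (intro sum_mono) (simp add: nrm_scale mult_right_mono cmod_lk_le_nrm)
  also have "\<dots> \<le> (\<Sum>j\<in>K. nrm x * nrm (b j))"
    by (rule sum_mono2) (use assms(1) in auto)
  finally show ?thesis by (simp add: sum_distrib_left)
qed

text \<open>\<open>g\<close> is the identity plus a map that kills every unmoved basis vector; this
  explains the \<open>1\<close> and the finite sum in \<open>K\<close>.\<close>

lemma isom_bounded:
  assumes "isom q g"
  obtains K where "1 \<le> K" "\<And>x. x \<in> Vsp q \<Longrightarrow> nrm (g x) \<le> K * nrm x"
proof
  let ?b = "\<lambda>i. g (bvec i) - bvec i"
  define K where "K = 1 + (\<Sum>j\<in>moved q g. nrm (?b j))"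
  show "1 \<le> K" by (simp add: K_def sum_nonneg)
  fix x assume x: "x \<in> Vsp q"
  have gL: "g \<in> lin_maps (supp (idx q)) (Vsp q)" and fin: "finite (moved q g)"
    using assms by (simp_all add: isom_def Vsp_eq)
  have "g x = lin (\<lambda>i. bvec i + ?b i) x"
    using lin_maps_eq_lin[OF gL] x by (simp add: Vsp_eq)
  then have "g x = x + lin ?b x"
    by (simp only: lin_add_fun lin_id)
  then have "nrm (g x) \<le> nrm x + nrm (lin ?b x)" by (simp add: nrm_triangle)
  also have "nrm (lin ?b x) \<le> nrm x * (\<Sum>j\<in>moved q g. nrm (?b j))"
    by (rule nrm_lin_le[OF fin, of "idx q"]) (use x in \<open>auto simp: moved_def Vsp_eq\<close>)
  finally show "nrm (g x) \<le> K * nrm x" by (simp add: K_def algebra_simps)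
qed

text \<open>
  Writing \<open>v + Z v = g w\<close> with \<open>g\<close> in \<open>SU(\<infinity>,q)\<close> gives
  \<open>|v| \<le> K |w|\<close> and \<open>|w|\<^sup>2 = |v|\<^sup>2 - |Z v|\<^sup>2\<close>, so the contraction is uniform.
\<close>

lemma uniform_contraction:
  assumes "Z \<in> matrix_domain q"
  obtains c where "c < 1" "\<And>v. v \<in> V_minus q \<Longrightarrow> nrm (Z v) \<le> c * nrm v"
proof -
  note Z = matrix_domain_lin_maps[OF assms]
  obtain g where g: "g \<in> SU q" "g ` V_minus q = graph_of q Z" by (rule SU_transitive[OF assms])
  have I: "isom q g" using g(1) by (simp add: SU_iff)
  obtain K where K: "1 \<le> K" "\<And>x. x \<in> Vsp q \<Longrightarrow> nrm (g x) \<le> K * nrm x"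
    by (rule isom_bounded[OF I]) blast
  \<comment> \<open>Substituting \<open>|w|\<^sup>2 = |v|\<^sup>2 - |Z v|\<^sup>2\<close> into
    \<open>|v|\<^sup>2 \<le> K\<^sup>2 |w|\<^sup>2\<close> and solving for \<open>|Z v|\<close>
    gives this constant; \<open>1 \<le> K\<close> keeps the radicand nonnegative.\<close>
  define c where "c = sqrt (1 - 1 / K\<^sup>2)"
  have "c < 1" using K(1) by (simp add: c_def)
  moreover have "nrm (Z v) \<le> c * nrm v" if v: "v \<in> V_minus q" for v
  proof -
    have Zv: "Z v \<in> V_plus" by (rule lin_maps_mem[OF Z v])
    have "v + Z v \<in> g ` V_minus q" using v g(2) by (simp add: graph_of_def)
    then obtain w where w: "w \<in> V_minus q" "g w = v + Z v" by auto
    have "- herm w w = - herm (g w) (g w)"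
      using I V_minus_Vsp[OF w(1)] by (simp add: isom_def)
    then have w2: "(nrm w)\<^sup>2 = (nrm v)\<^sup>2 - (nrm (Z v))\<^sup>2"
      using herm_split[OF Zv Zv v v] by (simp add: nrm_power2 w(2) herm_minus[OF w(1)])
    have "(nrm (g w))\<^sup>2 = (nrm v)\<^sup>2 + (nrm (Z v))\<^sup>2"
      using ip_plus_minus[OF Zv v] ip_minus_plus[OF v Zv]
      by (simp add: nrm_power2 w(2) ip.add_left ip.add_right)
    moreover have "(nrm (g w))\<^sup>2 \<le> K\<^sup>2 * (nrm w)\<^sup>2"
      using power_mono[OF K(2)[OF V_minus_Vsp[OF w(1)]], of 2] by (simp add: power_mult_distrib)
    ultimately have "(nrm v)\<^sup>2 \<le> K\<^sup>2 * ((nrm v)\<^sup>2 - (nrm (Z v))\<^sup>2)"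
      using zero_le_power2[of "nrm (Z v)"] unfolding w2 by linarith
    then have "(nrm v)\<^sup>2 / K\<^sup>2 \<le> (nrm v)\<^sup>2 - (nrm (Z v))\<^sup>2"
      using K(1) by (simp add: pos_divide_le_eq mult.commute)
    then have "(nrm (Z v))\<^sup>2 \<le> (1 - 1 / K\<^sup>2) * (nrm v)\<^sup>2"
      by (simp add: left_diff_distrib)
    then have "sqrt ((nrm (Z v))\<^sup>2) \<le> sqrt ((1 - 1 / K\<^sup>2) * (nrm v)\<^sup>2)"
      by (rule real_sqrt_le_mono)
    then show ?thesis by (simp add: c_def real_sqrt_mult)
  qed
  ultimately show ?thesis by (rule that)
qed

lemma contraction_matrix_domain:
  assumes "Z \<in> finitary_maps q" "\<And>v. v \<in> V_minus q \<Longrightarrow> v \<noteq> 0 \<Longrightarrow> nrm (Z v) < nrm v"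
  shows "Z \<in> matrix_domain q"
  unfolding matrix_domain_iff
  using assms by (auto simp: nrm_power2[symmetric] intro!: power_strict_mono)

lemma openin_block_topology:
  "openin (block_topology q n) U \<longleftrightarrow>
     (\<exists>N. open N \<and> U = (\<lambda>Z (i, j). entry Z i j) -` N \<inter> finitary_block q n)"
  by (simp add: block_topology_def openin_pullback_topology)

text \<open>If \<open>|Z0 v| \<le> c |v|\<close> with \<open>c < 1\<close>, a perturbation of
  operator norm below \<open>1 - c\<close> still gives a strict contraction. Within a block that
  norm is bounded by the sum of finitely many entry differences, which is continuous for entrywise
  convergence.\<close>

lemma openin_matrix_domain: "openin (finitary_topology q) (matrix_domain q)"
  unfolding openin_finitary_topology
proof (intro conjI allI)
  show "matrix_domain q \<subseteq> finitary_maps q" by (auto simp: matrix_domain_def)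
  fix n
  let ?e = "\<lambda>Z (i, j). entry Z i j"
  show "openin (block_topology q n) (matrix_domain q \<inter> finitary_block q n)"
  proof (subst openin_subopen, intro ballI)
    fix Z0 assume "Z0 \<in> matrix_domain q \<inter> finitary_block q n"
    then have Z0: "Z0 \<in> matrix_domain q" and Z0b: "Z0 \<in> finitary_block q n" by auto
    obtain c where c: "c < 1" "\<And>v. v \<in> V_minus q \<Longrightarrow> nrm (Z0 v) \<le> c * nrm v"
      by (rule uniform_contraction[OF Z0]) blast
    \<comment> \<open>The intersection with \<open>pos_idx q\<close> matters for finite
      \<open>q\<close>: beyond it a map takes the value \<open>undefined\<close>, and its entries
      carry no meaning.\<close>
    define R where "R = {- int n..- 1} \<times> ({1..int n} \<inter> pos_idx q)"
    define s where "s = (\<lambda>m :: int \<times> int \<Rightarrow> complex. \<Sum>p\<in>R. cmod (m p - ?e Z0 p))"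
    define N where "N = {m. s m < 1 - c}"
    have "open N"
      unfolding N_def s_def
      by (intro open_Collect_less continuous_on_sum continuous_on_norm continuous_on_diff
          continuous_on_const continuous_on_product_coordinates)
    then have "openin (block_topology q n) (?e -` N \<inter> finitary_block q n)"
      unfolding openin_block_topology by blast
    moreover have "Z0 \<in> ?e -` N \<inter> finitary_block q n"
      using Z0b c(1) by (simp add: N_def s_def)
    moreover have "?e -` N \<inter> finitary_block q n \<subseteq> matrix_domain q \<inter> finitary_block q n"
    proof
      fix Z assume "Z \<in> ?e -` N \<inter> finitary_block q n"
      then have Zs: "s (?e Z) < 1 - c" and Zb: "Z \<in> finitary_block q n" by (auto simp: N_def)
      have Zf: "Z \<in> finitary_maps q" using Zb by (simp add: finitary_block_def)
      note ZL = finitary_lin_maps[OF Zf] and ZL0 = matrix_domain_lin_maps[OF Z0]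
      let ?J = "{1..int n} \<inter> pos_idx q"
      let ?d = "\<lambda>j. Z (bvec j) - Z0 (bvec j)"
      have block: "lk (Y (bvec j)) i = 0"
        if "Y \<in> finitary_block q n" "j \<in> pos_idx q" "(i, j) \<notin> R" for Y i j
      proof (cases "i < 0")
        case True
        then show ?thesis
          using that pos_idx_pos[OF that(2)] by (force simp: finitary_block_def entry_def R_def)
      next
        case False
        have "Y (bvec j) \<in> V_plus"
        proof (rule lin_maps_mem[OF finitary_lin_maps[of Y q]])
          show "Y \<in> finitary_maps q" using that(1) by (simp add: finitary_block_def)
          show "bvec j \<in> V_minus q" using that(2) by simp
        qed
        then show ?thesis using False by (simp add: V_plus_eq supp_iff)
      qed
      have d_block: "lk (?d j) i = 0" if "j \<in> pos_idx q" "(i, j) \<notin> R" for i j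
        using block[OF Zb that] block[OF Z0b that] by (simp add: lk_minus)
      have d_out: "?d j = 0" if "j \<in> pos_idx q - ?J" for j
        by (rule poly_mapping_eqI) (use d_block[of j] that in \<open>auto simp: R_def\<close>)
      have d_in: "nrm (?d j) \<le> (\<Sum>i\<in>{- int n..- 1}. cmod (?e Z (i, j) - ?e Z0 (i, j)))" if "j \<in> ?J" for j
      proof -
        have "?d j \<in> supp {- int n..- 1}"
          using d_block[of j] that unfolding supp_iff by (auto simp: R_def)
        then show ?thesis using nrm_le_sum[of "{- int n..- 1}" "?d j"] by (simp add: lk_minus entry_def)
      qed
      have "(\<Sum>j\<in>?J. nrm (?d j)) \<le> (\<Sum>j\<in>?J. \<Sum>i\<in>{- int n..- 1}. cmod (?e Z (i, j) - ?e Z0 (i, j)))"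
        by (rule sum_mono) (rule d_in)
      also have "\<dots> = s (?e Z)"
        unfolding s_def R_def by (subst sum.swap) (simp add: sum.cartesian_product split_def)
      finally have dsum: "(\<Sum>j\<in>?J. nrm (?d j)) < 1 - c" using Zs by simp
      have "nrm (Z v) < nrm v" if v: "v \<in> V_minus q" "v \<noteq> 0" for v
      proof -
        have "Z v = lin (\<lambda>j. Z0 (bvec j) + ?d j) v"
          using lin_maps_eq_lin[OF ZL[unfolded V_minus_eq]] v(1) by (simp add: V_minus_eq)
        also have "\<dots> = Z0 v + lin ?d v"
          unfolding lin_add_fun
          using lin_maps_eq_lin[OF ZL0[unfolded V_minus_eq]] v(1) by (simp add: V_minus_eq)
        finally have "nrm (Z v) \<le> nrm (Z0 v) + nrm (lin ?d v)" by (simp add: nrm_triangle)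
        also have "nrm (lin ?d v) \<le> nrm v * (\<Sum>j\<in>?J. nrm (?d j))"
          by (rule nrm_lin_le[of _ "pos_idx q"]) (use d_out v(1) in \<open>auto simp: V_minus_eq\<close>)
        also have "\<dots> < nrm v * (1 - c)" using dsum nrm_pos[OF v(2)] by simp
        finally show ?thesis using c(2)[OF v(1)] by (simp add: algebra_simps)
      qed
      then show "Z \<in> matrix_domain q \<inter> finitary_block q n"
        using contraction_matrix_domain[OF Zf] Zb by blast
    qed
    ultimately show "\<exists>T. openin (block_topology q n) T \<and> Z0 \<in> T \<and>
        T \<subseteq> matrix_domain q \<inter> finitary_block q n" by blast
  qed
qed

section \<open>Connectedness along segments to the zero map\<close>

definition scaled :: "enat \<Rightarrow> (cvec \<Rightarrow> cvec) \<Rightarrow> real \<Rightarrow> cvec \<Rightarrow> cvec" where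
  "scaled q Z t = (\<lambda>v\<in>V_minus q. cscale (of_real t) (Z v))"

lemma scaled_finitary:
  assumes "Z \<in> finitary_maps q"
  shows "scaled q Z t \<in> finitary_maps q"
proof -
  note Z = finitary_lin_maps[OF assms]
  have "scaled q Z t \<in> lin_maps (V_minus q) V_plus"
    using lin_maps_mem[OF Z]
    by (auto simp: lin_maps_def scaled_def lin_maps_add[OF Z] lin_maps_scale[OF Z] cvec.subspace_add
        cvec.subspace_scale cvec.scale_right_distrib mult.commute)
  moreover have "cols q (scaled q Z t) \<subseteq> cols q Z"
    by (auto simp: cols_def scaled_def)
  ultimately show ?thesis
    using finitary_iff_cols finite_cols[OF assms] finite_subset by blast
qed

text \<open>Outside the domain the entry is that of the default vector, the same for all
  \<open>t\<close>, so these coordinates of the path are continuous too.\<close>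

lemma entry_scaled:
  "entry (scaled q Z t) i j = (if j \<in> pos_idx q then of_real t * entry Z i j else lk undefined i)"
  by (simp add: entry_def scaled_def)

lemma scaled_matrix_domain:
  assumes "Z \<in> matrix_domain q" "0 \<le> t" "t \<le> 1"
  shows "scaled q Z t \<in> matrix_domain q"
proof (rule contraction_matrix_domain)
  show "scaled q Z t \<in> finitary_maps q"
    by (rule scaled_finitary[OF matrix_domain_finitary[OF assms(1)]])
  fix v assume v: "v \<in> V_minus q" "v \<noteq> 0"
  have "nrm (Z v) < nrm v"
    using matrix_domain_contraction[OF assms(1) v] by (simp add: nrm_def)
  moreover have "nrm (scaled q Z t v) \<le> nrm (Z v)"
    using assms(2,3) v(1) by (simp add: scaled_def nrm_scale mult_left_le_one_le)
  ultimately show "nrm (scaled q Z t v) < nrm v" by simp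
qed

lemma finitary_block_exists:
  assumes "Z \<in> finitary_maps q"
  shows "\<exists>n. Z \<in> finitary_block q n"
proof -
  let ?E = "{(i, j). i \<in> neg_idx \<and> j \<in> pos_idx q \<and> entry Z i j \<noteq> 0}"
  have "finite ((\<lambda>(i, j). nat (\<bar>i\<bar> + \<bar>j\<bar>)) ` ?E)" using assms by (simp add: finitary_maps_def)
  then obtain n where n: "\<forall>k\<in>(\<lambda>(i, j). nat (\<bar>i\<bar> + \<bar>j\<bar>)) ` ?E. k \<le> n"
    using finite_nat_set_iff_bounded_le by blast
  have "- int n \<le> i \<and> j \<le> int n" if "i \<in> neg_idx" "j \<in> pos_idx q" "entry Z i j \<noteq> 0" for i j
  proof -
    have "(i, j) \<in> ?E" using that by simp
    then have "nat (\<bar>i\<bar> + \<bar>j\<bar>) \<le> n" using n by force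
    then show ?thesis by linarith
  qed
  then have "Z \<in> finitary_block q n" using assms by (simp add: finitary_block_def)
  then show ?thesis by blast
qed

lemma topspace_block_topology: "topspace (block_topology q n) = finitary_block q n"
  by (simp add: block_topology_def topspace_pullback_topology)

lemma topspace_finitary_topology: "topspace (finitary_topology q) = finitary_maps q"
proof
  show "topspace (finitary_topology q) \<subseteq> finitary_maps q"
    using openin_finitary_topology[THEN iffD1, OF openin_topspace] by blast
  have "openin (finitary_topology q) (finitary_maps q)"
    unfolding openin_finitary_topology
  proof (intro conjI allI)
    fix n
    have "finitary_maps q \<inter> finitary_block q n = topspace (block_topology q n)"
      by (auto simp: topspace_block_topology finitary_block_def)
    then show "openin (block_topology q n) (finitary_maps q \<inter> finitary_block q n)"
      by (simp only: openin_topspace)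
  qed simp
  then show "finitary_maps q \<subseteq> topspace (finitary_topology q)" by (rule openin_subset)
qed

text \<open>The inclusion of one stage into the direct limit: a path that stays in a block need only
  be continuous there.\<close>

lemma continuous_block_finitary: "continuous_map (block_topology q n) (finitary_topology q) id"
  unfolding continuous_map_def
proof (intro conjI allI impI)
  show "id \<in> topspace (block_topology q n) \<rightarrow> topspace (finitary_topology q)"
    by (auto simp: topspace_block_topology topspace_finitary_topology finitary_block_def)
  fix U assume "openin (finitary_topology q) U"
  then have "openin (block_topology q n) (U \<inter> finitary_block q n)"
    by (simp add: openin_finitary_topology)
  moreover have "{x \<in> topspace (block_topology q n). id x \<in> U} = U \<inter> finitary_block q n"
    by (auto simp: topspace_block_topology)
  ultimately show "openin (block_topology q n) {x \<in> topspace (block_topology q n). id x \<in> U}"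
    by simp
qed

text \<open>Scaling creates no new nonzero entries, so the whole segment stays in a single block,
  where every coordinate is affine in \<open>t\<close>.\<close>

lemma continuous_scaled:
  assumes "Z \<in> finitary_maps q"
  shows "continuous_map (top_of_set {0..1}) (finitary_topology q) (scaled q Z)"
proof -
  obtain n where n: "Z \<in> finitary_block q n" using finitary_block_exists[OF assms] by blast
  have "scaled q Z t \<in> finitary_block q n" for t
    using n scaled_finitary[OF assms] by (auto simp: finitary_block_def entry_scaled)
  moreover have "continuous_on {0..1} (\<lambda>t (i, j). entry (scaled q Z t) i j)"
  proof (rule continuous_on_coordinatewise_then_product)
    fix p :: "int \<times> int"
    obtain i j where p: "p = (i, j)" by force
    show "continuous_on {0..1} (\<lambda>t. case p of (i, j) \<Rightarrow> entry (scaled q Z t) i j)"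
      by (cases "j \<in> pos_idx q") (simp_all add: p entry_scaled continuous_intros)
  qed
  ultimately have "continuous_map (top_of_set {0..1}) (block_topology q n) (scaled q Z)"
    unfolding block_topology_def
    by (intro continuous_map_pullback') (auto simp: o_def)
  from continuous_map_compose[OF this continuous_block_finitary] show ?thesis by simp
qed

lemma connectedin_matrix_domain: "connectedin (finitary_topology q) (matrix_domain q)"
proof -
  let ?P = "\<lambda>Z. scaled q Z ` {0..1}"
  have "matrix_domain q \<subseteq> (\<Union>Z\<in>matrix_domain q. ?P Z)"
  proof
    fix Z assume Z: "Z \<in> matrix_domain q"
    have "scaled q Z 1 = Z"
      using lin_maps_ext[OF matrix_domain_lin_maps[OF Z]] by (auto simp: scaled_def restrict_def)
    then have "Z \<in> ?P Z" by (metis atLeastAtMost_iff image_eqI order_refl zero_le_one)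
    with Z show "Z \<in> (\<Union>Z\<in>matrix_domain q. ?P Z)" by blast
  qed
  moreover have "(\<Union>Z\<in>matrix_domain q. ?P Z) \<subseteq> matrix_domain q"
    using scaled_matrix_domain by auto
  moreover have "connectedin (finitary_topology q) (\<Union>Z\<in>matrix_domain q. ?P Z)"
  proof (rule connectedin_Union)
    fix S assume "S \<in> ?P ` matrix_domain q"
    then obtain Z where Z: "Z \<in> matrix_domain q" "S = ?P Z" by blast
    have "connectedin (top_of_set {0..1}) {0..1::real}"
      by (simp add: connectedin_subtopology connected_Icc)
    then show "connectedin (finitary_topology q) S"
      unfolding Z(2)
      by (rule connectedin_continuous_map_image[OF continuous_scaled[OF matrix_domain_finitary[OF Z(1)]]])
  next
    have "(\<lambda>v\<in>V_minus q. 0) \<in> ?P Z" for Z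
    proof -
      have "(\<lambda>v\<in>V_minus q. 0) = scaled q Z 0" by (simp add: scaled_def)
      then show ?thesis by (rule image_eqI) simp
    qed
    then show "\<Inter> (?P ` matrix_domain q) \<noteq> {}" by blast
  qed
  ultimately show ?thesis by (metis subset_antisym)
qed

lemma bounded_matrix_domain: "bounded_domain q (matrix_domain q)"
  unfolding bounded_domain_def
proof (intro conjI)
  show "matrix_domain q \<noteq> {}" using zero_matrix_domain by blast
  show "operator_bounded q (matrix_domain q)"
    unfolding operator_bounded_def
  proof (intro exI[of _ 1] ballI)
    fix Z v assume Z: "Z \<in> matrix_domain q" and v: "v \<in> V_minus q"
    show "sqrt (Re (ip (Z v) (Z v))) \<le> 1 * sqrt (Re (ip v v))"
    proof (cases "v = 0")
      case True
      then show ?thesis using lin_maps_zero[OF matrix_domain_lin_maps[OF Z]] by simp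
    next
      case False
      then show ?thesis using matrix_domain_contraction[OF Z v] by simp
    qed
  qed
qed (rule openin_matrix_domain connectedin_matrix_domain)+

theorem proposition4p1p3:
  fixes q :: enat
  shows "D0 q = (\<lambda>g. act g (base_flag q)) ` SU q \<and>
    bounded_domain q (matrix_domain q) \<and>
    (\<forall>F\<in>D0 q. \<exists>!Z. graph_map_of q F Z) \<and>
    bij_betw (Z_of q) (D0 q) (matrix_domain q) \<and>
    (\<forall>g\<in>SU q. \<forall>F\<in>D0 q. act g F \<in> D0 q \<and>
       bij_betw (denom q g (Z_of q F)) (V_minus q) (V_minus q) \<and>
       Z_of q (act g F) = frac_lin q g (Z_of q F))"
proof (intro conjI ballI)
  fix F assume "F \<in> D0 q"
  then obtain Z where "Z \<in> matrix_domain q" "F = ({0}, graph_of q Z, Vsp q)"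
    by (auto simp: D0_iff)
  then show "\<exists>!Z. graph_map_of q F Z"
    by (simp add: graph_map_of_graph[OF matrix_domain_lin_maps])
qed (rule D0_eq_orbit bounded_matrix_domain Z_of_bij act_D0 frac_lin_action; assumption)+

end
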